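(* Let $\tau\neq 0$ be an order type such that $\tau+\tau\le\tau$. Then for every ordinal $\alpha$, \[\langle {}^\alpha 2,<_{\mathrm{lex}}\rangle \not\rightarrow (\tau)^\tau.\]
   Context: Work in ZF (without the Axiom of Choice). For an ordinal $\alpha$, ${}^\alpha 2$ is the set of functions $\alpha\to\{0,1\}$, ordered lexicographically: $x<_{\mathrm{lex}}y$ iff $x(\delta)<y(\delta)$, where $\delta$ is the least ordinal with $x(\delta)\neq y(\delta)$. Order types are isomorphism classes of linear orders; $\sigma+\tau$ is the order type of a copy of $\sigma$ followed by a copy of $\tau$; for order types, $\sigma\le\tau$ means every linear order of type $\tau$ has a suborder of type $\sigma$. For a linear order $L$ and an order type $\sigma$, $[L]^\sigma$ is the set of subsets of $L$ whose induced order has type $\sigma$. For a linear order $L$, order types $\sigma,\tau$ and a set $\chi$, $L\rightarrow(\sigma)^\tau_\chi$ means: for every function $F:[L]^\tau\to\chi$ there is $H\in[L]^\sigma$ with $|\{F(B):B\in[H]^\tau\}|=1$; $\not\rightarrow$ denotes the negation; the subscript is omitted when $\chi=2=\{0,1\}$. *)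

theory Defs
  imports Main
begin

text \<open>
  The theorem is one of ZF, whereas HOL validates the axiom of choice (under which infinite-exponent
  relations fail for well-known reasons). It is therefore stated for an arbitrary model of
  first-order ZF: the elements of the type are the sets of the model, and all sets, functions and
  relations below are elements of the model. By the completeness theorem, truth in all such models
  is provability in ZF. Separation and Replacement must be restricted to first-order formulas with
  parameters: for arbitrary HOL predicates they would imply choice in the model.
\<close>

datatype form = Mem nat nat | Equal nat nat | Neg form | Conj form form | Exists nat form

primrec sat :: "('a \<Rightarrow> 'a \<Rightarrow> bool) \<Rightarrow> (nat \<Rightarrow> 'a) \<Rightarrow> form \<Rightarrow> bool" where
  "sat E e (Mem i j) \<longleftrightarrow> E (e i) (e j)"
| "sat E e (Equal i j) \<longleftrightarrow> e i = e j"
| "sat E e (Neg \<phi>) \<longleftrightarrow> \<not> sat E e \<phi>"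
| "sat E e (Conj \<phi> \<psi>) \<longleftrightarrow> sat E e \<phi> \<and> sat E e \<psi>"
| "sat E e (Exists i \<phi>) \<longleftrightarrow> (\<exists>a. sat E (e(i := a)) \<phi>)"

class zf =
  fixes mem :: "'a \<Rightarrow> 'a \<Rightarrow> bool" (infix \<open>\<^bold>\<in>\<close> 50)
  assumes extensionality: "(\<forall>z. z \<^bold>\<in> x \<longleftrightarrow> z \<^bold>\<in> y) \<longrightarrow> x = y"
    and foundation: "(\<exists>y. y \<^bold>\<in> x) \<longrightarrow> (\<exists>y. y \<^bold>\<in> x \<and> \<not> (\<exists>z. z \<^bold>\<in> x \<and> z \<^bold>\<in> y))"
    and pairing: "\<exists>p. \<forall>z. z \<^bold>\<in> p \<longleftrightarrow> z = x \<or> z = y"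
    and union: "\<exists>u. \<forall>z. z \<^bold>\<in> u \<longleftrightarrow> (\<exists>y. z \<^bold>\<in> y \<and> y \<^bold>\<in> x)"
    and power_set: "\<exists>p. \<forall>z. z \<^bold>\<in> p \<longleftrightarrow> (\<forall>w. w \<^bold>\<in> z \<longrightarrow> w \<^bold>\<in> x)"
    and infinity: "\<exists>w. (\<exists>u. u \<^bold>\<in> w \<and> (\<forall>z. \<not> z \<^bold>\<in> u)) \<and>
          (\<forall>n. n \<^bold>\<in> w \<longrightarrow> (\<exists>s. s \<^bold>\<in> w \<and> (\<forall>z. z \<^bold>\<in> s \<longleftrightarrow> z \<^bold>\<in> n \<or> z = n)))"
    and separation: "\<exists>s. \<forall>x. x \<^bold>\<in> s \<longleftrightarrow> x \<^bold>\<in> a \<and> sat mem (e(0 := x)) \<phi>"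
    and replacement: "(\<forall>x. x \<^bold>\<in> a \<longrightarrow> (\<exists>!y. sat mem (e(0 := x, 1 := y)) \<phi>)) \<longrightarrow>
          (\<exists>b. \<forall>y. y \<^bold>\<in> b \<longleftrightarrow> (\<exists>x. x \<^bold>\<in> a \<and> sat mem (e(0 := x, 1 := y)) \<phi>))"

text \<open>
  The set of the model with extension \<open>P\<close>. It is meaningful only if there is such a set, which ZF
  proves in all uses below.
\<close>

definition setof :: "('a::zf \<Rightarrow> bool) \<Rightarrow> 'a" where
  "setof P = (THE s. \<forall>x. x \<^bold>\<in> s \<longleftrightarrow> P x)"

definition sub :: "'a::zf \<Rightarrow> 'a \<Rightarrow> bool" (infix \<open>\<^bold>\<subseteq>\<close> 50) where
  "x \<^bold>\<subseteq> y \<longleftrightarrow> (\<forall>z. z \<^bold>\<in> x \<longrightarrow> z \<^bold>\<in> y)"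

definition emptyset :: "'a::zf" where
  "emptyset = setof (\<lambda>x. False)"

definition upair :: "'a::zf \<Rightarrow> 'a \<Rightarrow> 'a" where
  "upair x y = setof (\<lambda>z. z = x \<or> z = y)"

definition opair :: "'a::zf \<Rightarrow> 'a \<Rightarrow> 'a" where
  "opair x y = upair (upair x x) (upair x y)"

definition two :: "'a::zf" where
  "two = upair emptyset (upair emptyset emptyset)"

definition func :: "'a::zf \<Rightarrow> 'a \<Rightarrow> 'a \<Rightarrow> bool" where
  "func f A B \<longleftrightarrow>
     (\<forall>p. p \<^bold>\<in> f \<longrightarrow> (\<exists>a b. a \<^bold>\<in> A \<and> b \<^bold>\<in> B \<and> p = opair a b)) \<and>
     (\<forall>a. a \<^bold>\<in> A \<longrightarrow> (\<exists>!b. opair a b \<^bold>\<in> f))"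

definition app :: "'a::zf \<Rightarrow> 'a \<Rightarrow> 'a" where
  "app f x = (THE y. opair x y \<^bold>\<in> f)"

definition ordinal :: "'a::zf \<Rightarrow> bool" where
  "ordinal \<alpha> \<longleftrightarrow>
     (\<forall>\<beta>. \<beta> \<^bold>\<in> \<alpha> \<longrightarrow> \<beta> \<^bold>\<subseteq> \<alpha>) \<and>
     (\<forall>\<beta>. \<beta> \<^bold>\<in> \<alpha> \<longrightarrow> \<not> \<beta> \<^bold>\<in> \<beta>) \<and>
     (\<forall>\<beta> \<gamma> \<delta>. \<beta> \<^bold>\<in> \<alpha> \<and> \<gamma> \<^bold>\<in> \<alpha> \<and> \<delta> \<^bold>\<in> \<alpha> \<and> \<beta> \<^bold>\<in> \<gamma> \<and> \<gamma> \<^bold>\<in> \<delta> \<longrightarrow> \<beta> \<^bold>\<in> \<delta>) \<and>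
     (\<forall>\<beta> \<gamma>. \<beta> \<^bold>\<in> \<alpha> \<and> \<gamma> \<^bold>\<in> \<alpha> \<longrightarrow> \<beta> \<^bold>\<in> \<gamma> \<or> \<beta> = \<gamma> \<or> \<gamma> \<^bold>\<in> \<beta>) \<and>
     (\<forall>X. X \<^bold>\<subseteq> \<alpha> \<and> (\<exists>\<beta>. \<beta> \<^bold>\<in> X) \<longrightarrow>
        (\<exists>\<beta>. \<beta> \<^bold>\<in> X \<and> (\<forall>\<gamma>. \<gamma> \<^bold>\<in> X \<longrightarrow> \<beta> = \<gamma> \<or> \<beta> \<^bold>\<in> \<gamma>)))"

text \<open>
  \<open>(X, R)\<close> stands for the set \<open>X\<close> ordered by the restriction of \<open>R\<close> to \<open>X\<close>; as \<open>R\<close> may contain further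
  pairs, \<open>(Y, R)\<close> is the induced order on a subset \<open>Y\<close> of \<open>X\<close>.
\<close>

definition linord :: "'a::zf \<times> 'a \<Rightarrow> bool" where
  "linord = (\<lambda>(X, R).
     (\<forall>x. x \<^bold>\<in> X \<longrightarrow> \<not> opair x x \<^bold>\<in> R) \<and>
     (\<forall>x y z. x \<^bold>\<in> X \<and> y \<^bold>\<in> X \<and> z \<^bold>\<in> X \<and> opair x y \<^bold>\<in> R \<and> opair y z \<^bold>\<in> R \<longrightarrow> opair x z \<^bold>\<in> R) \<and>
     (\<forall>x y. x \<^bold>\<in> X \<and> y \<^bold>\<in> X \<longrightarrow> opair x y \<^bold>\<in> R \<or> x = y \<or> opair y x \<^bold>\<in> R))"

definition order_iso :: "'a::zf \<times> 'a \<Rightarrow> 'a \<times> 'a \<Rightarrow> bool" where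
  "order_iso = (\<lambda>(X, R) (Y, S). \<exists>f. func f X Y \<and>
     (\<forall>y. y \<^bold>\<in> Y \<longrightarrow> (\<exists>!x. x \<^bold>\<in> X \<and> app f x = y)) \<and>
     (\<forall>x x'. x \<^bold>\<in> X \<and> x' \<^bold>\<in> X \<longrightarrow> (opair x x' \<^bold>\<in> R \<longleftrightarrow> opair (app f x) (app f x') \<^bold>\<in> S)))"

text \<open>
  An order type is a class of the model, hence a HOL set of linear orders; it is determined by any
  of its members, so a quantifier over order types is one over the linear orders of the model.
\<close>

type_synonym 'a otype = "('a \<times> 'a) set"

definition type_of :: "'a::zf \<times> 'a \<Rightarrow> 'a otype" where
  "type_of L = {M. linord M \<and> order_iso L M}"

definition order_type :: "'a::zf otype \<Rightarrow> bool" where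
  "order_type \<tau> \<longleftrightarrow> (\<exists>L. linord L \<and> \<tau> = type_of L)"

definition ozero :: "'a::zf otype" where
  "ozero = type_of (emptyset, emptyset)"

definition oplus :: "'a::zf otype \<Rightarrow> 'a otype \<Rightarrow> 'a otype" (infixl \<open>\<^bold>+\<close> 65) where
  "\<sigma> \<^bold>+ \<tau> = {(X, R). linord (X, R) \<and>
     (\<exists>A B. (A, R) \<in> \<sigma> \<and> (B, R) \<in> \<tau> \<and> (\<forall>x. x \<^bold>\<in> X \<longleftrightarrow> x \<^bold>\<in> A \<or> x \<^bold>\<in> B) \<and>
        (\<forall>a b. a \<^bold>\<in> A \<and> b \<^bold>\<in> B \<longrightarrow> opair a b \<^bold>\<in> R))}"

definition ole :: "'a::zf otype \<Rightarrow> 'a otype \<Rightarrow> bool" (infix \<open>\<^bold>\<le>\<close> 50) where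
  "\<sigma> \<^bold>\<le> \<tau> \<longleftrightarrow> (\<forall>(X, R) \<in> \<tau>. \<exists>Y. Y \<^bold>\<subseteq> X \<and> (Y, R) \<in> \<sigma>)"

definition suborders :: "'a::zf \<times> 'a \<Rightarrow> 'a otype \<Rightarrow> 'a" where
  "suborders = (\<lambda>(X, R) \<sigma>. setof (\<lambda>Y. Y \<^bold>\<subseteq> X \<and> (Y, R) \<in> \<sigma>))"

definition arrow :: "'a::zf \<times> 'a \<Rightarrow> 'a otype \<Rightarrow> 'a otype \<Rightarrow> 'a \<Rightarrow> bool" where
  "arrow = (\<lambda>(X, R) \<sigma> \<tau> \<chi>. \<forall>F. func F (suborders (X, R) \<tau>) \<chi> \<longrightarrow>
     (\<exists>H. H \<^bold>\<in> suborders (X, R) \<sigma> \<and> (\<exists>!c. \<exists>B. B \<^bold>\<in> suborders (H, R) \<tau> \<and> app F B = c)))"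

definition seqs2 :: "'a::zf \<Rightarrow> 'a" where
  "seqs2 \<alpha> = setof (\<lambda>x. func x \<alpha> two)"

text \<open>On the values \<open>0\<close> and \<open>1\<close>, the order \<open><\<close> is membership.\<close>

definition lex_less :: "'a::zf \<Rightarrow> 'a \<Rightarrow> 'a \<Rightarrow> bool" where
  "lex_less \<alpha> x y \<longleftrightarrow> (\<exists>\<delta>. \<delta> \<^bold>\<in> \<alpha> \<and> app x \<delta> \<noteq> app y \<delta> \<and>
     (\<forall>\<gamma>. \<gamma> \<^bold>\<in> \<delta> \<longrightarrow> app x \<gamma> = app y \<gamma>) \<and> app x \<delta> \<^bold>\<in> app y \<delta>)"

definition lex_order :: "'a::zf \<Rightarrow> 'a" where
  "lex_order \<alpha> = setof (\<lambda>p. \<exists>x y. x \<^bold>\<in> seqs2 \<alpha> \<and> y \<^bold>\<in> seqs2 \<alpha> \<and> lex_less \<alpha> x y \<and> p = opair x y)"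

end

theory Submission imports Defs begin

text \<open>
  A subset \<open>B\<close> of \<open>\<^sup>\<alpha>2\<close> with at least two elements has a first splitting level, which cuts it into a
  lower half \<open>U\<close> and an upper half \<open>V\<close>. Colour \<open>B\<close> by whether \<open>U\<close> splits later than \<open>V\<close>. Since
  \<open>\<tau> + \<tau> \<le> \<tau>\<close>, a set \<open>H\<close> of type \<open>\<tau>\<close> has, by a well-foundedness argument on levels, a node with copies
  of \<open>\<tau>\<close> on both sides, and hence subsets \<open>U \<union> V\<close> of type \<open>\<tau>\<close> both of whose halves contain copies
  of \<open>\<tau>\<close>. Replacing \<open>U\<close> by a copy of it inside a copy of \<open>\<tau>\<close> contained in \<open>U\<close> raises the splitting
  level of \<open>U\<close> without changing that of \<open>V\<close>; if \<open>V\<close> splits as early as possible, \<open>U\<close> can be made to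
  split later than \<open>V\<close>. The same with the sides exchanged yields the other colour.
\<close>

text \<open>Two copies, one below the other, need not be separated at a single node: the elements of
  the lower one may leave a branch at ever higher levels. This obstacle is what the well-foundedness
  argument removes. Even with a copy on either side of a node, the union of the two need not have
  type \<open>\<tau>\<close>; so the left copy is cut in two and its upper piece is carried to the
  right of the node. The splitting levels of the two halves make a useful colour because either half
  can be exchanged for an isomorphic set while the other stays fixed. Least levels are taken inside
  the model, where they are available only for definable predicates; this is why digits are read off
  pairs and isomorphisms are treated as relations.\<close>

section \<open>Definable predicates\<close>

text \<open>
  \<open>P\<close> is defined by a first-order formula with parameters: the free variables are placed according
  to any \<open>\<rho>\<close>, and the variables in \<open>F\<close>, chosen from any infinite supply \<open>U\<close> of unused ones, carry the
  parameters \<open>p\<close>. The freedom in \<open>\<rho>\<close> and \<open>U\<close> makes renaming and conjunction unproblematic.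
\<close>

definition fo :: "((nat \<Rightarrow> 'a::zf) \<Rightarrow> bool) \<Rightarrow> bool" where
  "fo P \<longleftrightarrow> (\<forall>\<rho> U. infinite U \<longrightarrow> U \<inter> range \<rho> = {} \<longrightarrow>
     (\<exists>\<phi> p F. finite F \<and> F \<subseteq> U \<and>
        (\<forall>e. (\<forall>i\<in>F. e i = p i) \<longrightarrow> (sat mem e \<phi> \<longleftrightarrow> P (\<lambda>i. e (\<rho> i))))))"

text \<open>Definability of the graph, as formulas have no compound terms.\<close>

definition fot :: "((nat \<Rightarrow> 'a::zf) \<Rightarrow> 'a) \<Rightarrow> bool" where
  "fot t \<longleftrightarrow> fo (\<lambda>e. e 0 = t (\<lambda>i. e (Suc i)))"

lemma foI:
  assumes "\<And>\<rho> U. infinite U \<Longrightarrow> U \<inter> range \<rho> = {} \<Longrightarrow>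
    \<exists>\<phi> p F. finite F \<and> F \<subseteq> U \<and>
      (\<forall>e. (\<forall>i\<in>F. e i = p i) \<longrightarrow> (sat mem e \<phi> \<longleftrightarrow> P (\<lambda>i. e (\<rho> i))))"
  shows "fo P"
  unfolding fo_def by (intro allI impI) (rule assms)

lemma foE:
  assumes "fo P" "infinite U" "U \<inter> range \<rho> = {}"
  obtains \<phi> p F where "finite F" "F \<subseteq> U"
    "\<forall>e. (\<forall>i\<in>F. e i = p i) \<longrightarrow> (sat mem e \<phi> \<longleftrightarrow> P (\<lambda>i. e (\<rho> i)))"
  using assms(1)[unfolded fo_def, rule_format, OF assms(2,3)]
  by (elim exE conjE) (rule that)

lemma fo_rename:
  assumes "fo P"
  shows "fo (\<lambda>e. P (\<lambda>i. e (f i)))"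
proof (rule foI)
  fix \<rho> :: "nat \<Rightarrow> nat" and U :: "nat set"
  assume U: "infinite U" "U \<inter> range \<rho> = {}"
  have "U \<inter> range (\<lambda>i. \<rho> (f i)) = {}" using U(2) by auto
  from assms[unfolded fo_def, rule_format, OF U(1) this]
  show "\<exists>\<phi> p F. finite F \<and> F \<subseteq> U \<and>
        (\<forall>e. (\<forall>i\<in>F. e i = p i) \<longrightarrow> sat (\<^bold>\<in>) e \<phi> = P (\<lambda>i. e (\<rho> (f i))))" .
qed

lemma fo_atom_mem: "fo (\<lambda>e. e i \<^bold>\<in> e j)"
proof (rule foI)
  fix \<rho> :: "nat \<Rightarrow> nat" and U :: "nat set"
  show "\<exists>\<phi> p F. finite F \<and> F \<subseteq> U \<and>
        (\<forall>e. (\<forall>i\<in>F. e i = p i) \<longrightarrow> sat (\<^bold>\<in>) e \<phi> = (e (\<rho> i) \<^bold>\<in> e (\<rho> j)))"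
    by (intro exI[of _ "Mem (\<rho> i) (\<rho> j)"] exI[of _ undefined] exI[of _ "{}"]) simp
qed

lemma fo_atom_eq: "fo (\<lambda>e. e i = e j)"
proof (rule foI)
  fix \<rho> :: "nat \<Rightarrow> nat" and U :: "nat set"
  show "\<exists>\<phi> p F. finite F \<and> F \<subseteq> U \<and>
        (\<forall>e. (\<forall>i\<in>F. e i = p i) \<longrightarrow> sat (\<^bold>\<in>) e \<phi> = (e (\<rho> i) = e (\<rho> j)))"
    by (intro exI[of _ "Equal (\<rho> i) (\<rho> j)"] exI[of _ undefined] exI[of _ "{}"]) simp
qed

lemma fo_atom_const: "fo (\<lambda>e. e i = c)"
proof (rule foI)
  fix \<rho> :: "nat \<Rightarrow> nat" and U :: "nat set"
  assume "infinite U"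
  then obtain m where "m \<in> U" using infinite_imp_nonempty by blast
  then show "\<exists>\<phi> p F. finite F \<and> F \<subseteq> U \<and>
        (\<forall>e. (\<forall>i\<in>F. e i = p i) \<longrightarrow> sat (\<^bold>\<in>) e \<phi> = (e (\<rho> i) = c))"
    by (intro exI[of _ "Equal (\<rho> i) m"] exI[of _ "\<lambda>_. c"] exI[of _ "{m}"]) simp
qed

lemma fo_not:
  assumes "fo P"
  shows "fo (\<lambda>e. \<not> P e)"
proof (rule foI)
  fix \<rho> :: "nat \<Rightarrow> nat" and U :: "nat set"
  assume U: "infinite U" "U \<inter> range \<rho> = {}"
  obtain \<phi> p F where "finite F" "F \<subseteq> U"
    "\<forall>e. (\<forall>i\<in>F. e i = p i) \<longrightarrow> sat (\<^bold>\<in>) e \<phi> = P (\<lambda>i. e (\<rho> i))"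
    by (rule foE[OF assms U]) (rule that)
  then show "\<exists>\<phi> p F. finite F \<and> F \<subseteq> U \<and>
        (\<forall>e. (\<forall>i\<in>F. e i = p i) \<longrightarrow> sat (\<^bold>\<in>) e \<phi> = (\<not> P (\<lambda>i. e (\<rho> i))))"
    by (intro exI[of _ "Neg \<phi>"] exI[of _ p] exI[of _ F]) simp
qed

lemma fo_conj:
  assumes P: "fo P" and Q: "fo Q"
  shows "fo (\<lambda>e. P e \<and> Q e)"
proof (rule foI)
  fix \<rho> :: "nat \<Rightarrow> nat" and U :: "nat set"
  assume U: "infinite U" "U \<inter> range \<rho> = {}"
  obtain \<phi> p F where 1: "finite F" "F \<subseteq> U"
    "\<forall>e. (\<forall>i\<in>F. e i = p i) \<longrightarrow> sat (\<^bold>\<in>) e \<phi> = P (\<lambda>i. e (\<rho> i))"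
    by (rule foE[OF P U]) (rule that)
  \<comment> \<open>The second formula draws its parameters from outside \<open>F\<close>, so that
    one valuation serves both formulas.\<close>
  have U': "infinite (U - F)" "(U - F) \<inter> range \<rho> = {}" using U 1 by auto
  obtain \<psi> q G where 2: "finite G" "G \<subseteq> U - F"
    "\<forall>e. (\<forall>i\<in>G. e i = q i) \<longrightarrow> sat (\<^bold>\<in>) e \<psi> = Q (\<lambda>i. e (\<rho> i))"
    by (rule foE[OF Q U']) (rule that)
  show "\<exists>\<phi> p F. finite F \<and> F \<subseteq> U \<and>
        (\<forall>e. (\<forall>i\<in>F. e i = p i) \<longrightarrow> sat (\<^bold>\<in>) e \<phi> = (P (\<lambda>i. e (\<rho> i)) \<and> Q (\<lambda>i. e (\<rho> i))))"
  proof (intro exI[of _ "Conj \<phi> \<psi>"] exI[of _ "\<lambda>i. if i \<in> F then p i else q i"] exI[of _ "F \<union> G"]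
      conjI allI impI)
    fix e assume e: "\<forall>i\<in>F \<union> G. e i = (if i \<in> F then p i else q i)"
    have "\<forall>i\<in>F. e i = p i" "\<forall>i\<in>G. e i = q i" using e 2(2) by auto
    then show "sat (\<^bold>\<in>) e (Conj \<phi> \<psi>) = (P (\<lambda>i. e (\<rho> i)) \<and> Q (\<lambda>i. e (\<rho> i)))"
      by (simp add: 1(3) 2(3))
  qed (use 1(1,2) 2(1,2) in auto)
qed

text \<open>The bound variable becomes variable \<open>0\<close>, as in de Bruijn notation.\<close>

lemma fo_ex:
  assumes P: "fo (\<lambda>e. P (e 0) (\<lambda>i. e (Suc i)))"
  shows "fo (\<lambda>e. \<exists>x. P x e)"
proof (rule foI)
  fix \<rho> :: "nat \<Rightarrow> nat" and U :: "nat set"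
  assume U: "infinite U" "U \<inter> range \<rho> = {}"
  then obtain m where m: "m \<in> U" using infinite_imp_nonempty by blast
  have U': "infinite (U - {m})" "(U - {m}) \<inter> range (case_nat m \<rho>) = {}"
    using U by (auto split: nat.splits)
  obtain \<phi> p F where 1: "finite F" "F \<subseteq> U - {m}"
    "\<forall>e. (\<forall>i\<in>F. e i = p i) \<longrightarrow> sat (\<^bold>\<in>) e \<phi> =
      P (e (case_nat m \<rho> 0)) (\<lambda>i. e (case_nat m \<rho> (Suc i)))"
    by (rule foE[OF P U']) (rule that)
  have m': "\<rho> i \<noteq> m" for i using m U by auto
  have "sat (\<^bold>\<in>) (e(m := a)) \<phi> = P a (\<lambda>i. e (\<rho> i))" if "\<forall>i\<in>F. e i = p i" for e a
  proof -
    have "\<forall>i\<in>F. (e(m := a)) i = p i" using that 1(2) by auto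
    then show ?thesis using 1(3)[rule_format, of "e(m := a)"] m' by simp
  qed
  then show "\<exists>\<phi> p F. finite F \<and> F \<subseteq> U \<and>
        (\<forall>e. (\<forall>i\<in>F. e i = p i) \<longrightarrow> sat (\<^bold>\<in>) e \<phi> = (\<exists>x. P x (\<lambda>i. e (\<rho> i))))"
    using 1(1,2) by (intro exI[of _ "Exists m \<phi>"] exI[of _ p] exI[of _ F]) auto
qed

lemma fo_const: "fo (\<lambda>e. b)"
proof (cases b)
  case True
  then show ?thesis using fo_atom_eq[of 0 0] by simp
next
  case False
  then show ?thesis using fo_not[OF fo_atom_eq[of 0 0]] by simp
qed

lemma fo_disj:
  assumes "fo P" "fo Q"
  shows "fo (\<lambda>e. P e \<or> Q e)"
proof -
  have "fo (\<lambda>e. \<not> (\<not> P e \<and> \<not> Q e))" by (intro fo_not fo_conj assms)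
  then show ?thesis by simp
qed

lemma fo_imp:
  assumes "fo P" "fo Q"
  shows "fo (\<lambda>e. P e \<longrightarrow> Q e)"
proof -
  have "fo (\<lambda>e. \<not> P e \<or> Q e)" by (intro fo_not fo_disj assms)
  then show ?thesis by (simp only: imp_conv_disj)
qed

lemma fo_iff:
  assumes "fo P" "fo Q"
  shows "fo (\<lambda>e. P e = Q e)"
proof -
  have "fo (\<lambda>e. (P e \<longrightarrow> Q e) \<and> (Q e \<longrightarrow> P e))" by (intro fo_conj fo_imp assms)
  then show ?thesis by (simp only: iff_conv_conj_imp)
qed

lemma fo_all:
  assumes "fo (\<lambda>e. P (e 0) (\<lambda>i. e (Suc i)))"
  shows "fo (\<lambda>e. \<forall>x. P x e)"
proof -
  have "fo (\<lambda>e. \<not> (\<exists>x. \<not> P x e))" by (intro fo_not fo_ex assms)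
  then show ?thesis by simp
qed

section \<open>Definable terms and their substitution\<close>

lemma fot_var: "fot (\<lambda>e. e i)"
  unfolding fot_def by (rule fo_atom_eq)

lemma fot_const: "fot (\<lambda>e. c)"
  unfolding fot_def by (rule fo_atom_const)

lemma fot_rename:
  assumes "fot t"
  shows "fot (\<lambda>e. t (\<lambda>i. e (f i)))"
  using fo_rename[OF assms[unfolded fot_def], of "case_nat 0 (\<lambda>i. Suc (f i))"]
  unfolding fot_def by simp

text \<open>By the one-point rule the value of \<open>t\<close> becomes a quantified variable, and
  \<open>t\<close> enters only through its graph.\<close>

lemma fo_subst:
  assumes "fo (\<lambda>e. P (e 0) (\<lambda>i. e (Suc i)))" "fot t"
  shows "fo (\<lambda>e. P (t e) e)"
proof -
  have "fo (\<lambda>e. \<exists>x. x = t e \<and> P x e)"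
    using assms unfolding fot_def by (intro fo_ex fo_conj)
  then show ?thesis by simp
qed

lemma fo_mem:
  assumes "fot s" "fot t"
  shows "fo (\<lambda>e. s e \<^bold>\<in> t e)"
  by (rule fo_subst[where P = "\<lambda>x e. x \<^bold>\<in> t e", OF _ assms(1)],
      rule fo_subst[where P = "\<lambda>x e. e 0 \<^bold>\<in> x", OF _ fot_rename[OF assms(2)]],
      rule fo_atom_mem)

lemma fo_eq:
  assumes "fot s" "fot t"
  shows "fo (\<lambda>e. s e = t e)"
  by (rule fo_subst[where P = "\<lambda>x e. x = t e", OF _ assms(1)],
      rule fo_subst[where P = "\<lambda>x e. e 0 = x", OF _ fot_rename[OF assms(2)]],
      rule fo_atom_eq)

lemma fo_separation:
  assumes "fo (\<lambda>e. P (e 0))"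
  shows "\<exists>s. \<forall>x. x \<^bold>\<in> s \<longleftrightarrow> x \<^bold>\<in> a \<and> P x"
proof -
  \<comment> \<open>The free variable is placed at \<open>0\<close>, the slot that the Separation
    axiom reserves for the element; the parameters occupy the others.\<close>
  have U: "infinite {1::nat..}" "{1::nat..} \<inter> range (\<lambda>i::nat. 0::nat) = {}"
    by (auto simp: infinite_Ici)
  obtain \<phi> p F where F: "finite F" "F \<subseteq> {1..}"
    and *: "\<forall>e. (\<forall>i\<in>F. e i = p i) \<longrightarrow> sat (\<^bold>\<in>) e \<phi> = P (e 0)"
    by (rule foE[OF assms U]) (rule that)
  have "sat (\<^bold>\<in>) (p(0 := x)) \<phi> = P x" for x
  proof -
    have "\<forall>i\<in>F. (p(0 := x)) i = p i" using F(2) by auto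
    then show ?thesis using *[rule_format, of "p(0 := x)"] by simp
  qed
  then show ?thesis using separation[of a p \<phi>] by simp
qed

section \<open>Sets of the model\<close>

lemma set_eqI: "(\<And>z. z \<^bold>\<in> x \<longleftrightarrow> z \<^bold>\<in> y) \<Longrightarrow> x = (y::'a::zf)"
  using extensionality by blast

lemma mem_setof:
  assumes "\<exists>s::'a::zf. \<forall>x. x \<^bold>\<in> s \<longleftrightarrow> P x"
  shows "x \<^bold>\<in> setof P \<longleftrightarrow> P x"
proof -
  have "\<exists>!s::'a. \<forall>x. x \<^bold>\<in> s \<longleftrightarrow> P x" using assms by (auto intro: set_eqI)
  from theI'[OF this] show ?thesis unfolding setof_def by blast
qed

definition sep :: "'a::zf \<Rightarrow> ('a \<Rightarrow> bool) \<Rightarrow> 'a" where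
  "sep a P = setof (\<lambda>x. x \<^bold>\<in> a \<and> P x)"

definition cup :: "'a::zf \<Rightarrow> 'a \<Rightarrow> 'a" where
  "cup a b = setof (\<lambda>x. x \<^bold>\<in> a \<or> x \<^bold>\<in> b)"

definition one :: "'a::zf" where
  "one = upair emptyset emptyset"

lemma mem_sep: "fo (\<lambda>e. P (e 0)) \<Longrightarrow> x \<^bold>\<in> sep a P \<longleftrightarrow> x \<^bold>\<in> a \<and> P x"
  unfolding sep_def by (rule mem_setof[OF fo_separation])

lemma mem_emptyset [simp]: "\<not> x \<^bold>\<in> emptyset"
  unfolding emptyset_def using mem_setof[of "\<lambda>x. False"] fo_separation[OF fo_const[of False]]
  by simp

lemma mem_upair [simp]: "x \<^bold>\<in> upair a b \<longleftrightarrow> x = a \<or> x = b"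
  unfolding upair_def by (rule mem_setof[OF pairing])

lemma mem_cup [simp]: "x \<^bold>\<in> cup a b \<longleftrightarrow> x \<^bold>\<in> a \<or> x \<^bold>\<in> b"
proof -
  obtain u where "\<forall>z. z \<^bold>\<in> u \<longleftrightarrow> (\<exists>y. z \<^bold>\<in> y \<and> y \<^bold>\<in> upair a b)" using union by blast
  then have "\<exists>s. \<forall>x. x \<^bold>\<in> s \<longleftrightarrow> x \<^bold>\<in> a \<or> x \<^bold>\<in> b" by (intro exI[of _ u]) auto
  then show ?thesis unfolding cup_def by (rule mem_setof)
qed

lemma upair_eq_iff: "upair a b = upair c d \<longleftrightarrow> a = c \<and> b = d \<or> a = d \<and> b = (c::'a::zf)"
proof
  assume eq: "upair a b = upair c d"
  have "z = a \<or> z = b \<longleftrightarrow> z = c \<or> z = d" for z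
    using arg_cong[OF eq, of "\<lambda>u. z \<^bold>\<in> u"] by simp
  from this[of a] this[of b] this[of c] this[of d]
  show "a = c \<and> b = d \<or> a = d \<and> b = c" by auto
next
  assume "a = c \<and> b = d \<or> a = d \<and> b = c"
  then show "upair a b = upair c d" by (intro set_eqI) auto
qed

lemma opair_eq_iff [simp]: "opair a b = opair c d \<longleftrightarrow> a = c \<and> b = (d::'a::zf)"
  unfolding opair_def upair_eq_iff by auto

lemma one_neq_emptyset [simp]: "(one::'a::zf) \<noteq> emptyset" "emptyset \<noteq> (one::'a)"
proof -
  have "emptyset \<^bold>\<in> (one::'a)" by (simp add: one_def)
  then show "(one::'a) \<noteq> emptyset" by auto
  then show "emptyset \<noteq> (one::'a)" by simp
qed

lemma mem_two [simp]: "x \<^bold>\<in> two \<longleftrightarrow> x = emptyset \<or> x = one"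
  unfolding two_def one_def by simp

lemma mem_one [simp]: "x \<^bold>\<in> one \<longleftrightarrow> x = emptyset"
  unfolding one_def by simp

lemma subI: "(\<And>z. z \<^bold>\<in> x \<Longrightarrow> z \<^bold>\<in> y) \<Longrightarrow> x \<^bold>\<subseteq> y"
  unfolding sub_def by blast

lemma subD: "x \<^bold>\<subseteq> y \<Longrightarrow> z \<^bold>\<in> x \<Longrightarrow> z \<^bold>\<in> y"
  unfolding sub_def by blast

lemma sub_refl: "x \<^bold>\<subseteq> x"
  unfolding sub_def by blast

lemma sub_trans: "x \<^bold>\<subseteq> y \<Longrightarrow> y \<^bold>\<subseteq> z \<Longrightarrow> x \<^bold>\<subseteq> z"
  unfolding sub_def by blast

lemma fot_upair:
  fixes s :: "(nat \<Rightarrow> 'a::zf) \<Rightarrow> 'a"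
  assumes "fot s" "fot t"
  shows "fot (\<lambda>e. upair (s e) (t e))"
proof -
  have eq: "e 0 = upair (s (\<lambda>i. e (Suc i))) (t (\<lambda>i. e (Suc i))) \<longleftrightarrow>
      (\<forall>z. z \<^bold>\<in> e 0 \<longleftrightarrow> z = s (\<lambda>i. e (Suc i)) \<or> z = t (\<lambda>i. e (Suc i)))" for e :: "nat \<Rightarrow> 'a"
    by (auto intro: set_eqI)
  show ?thesis unfolding fot_def eq
    by (intro fo_all fo_iff fo_disj fo_mem fo_eq fot_var
        fot_rename[OF assms(1), of "\<lambda>i. Suc (Suc i)"] fot_rename[OF assms(2), of "\<lambda>i. Suc (Suc i)"])
qed

lemma fot_opair: "fot s \<Longrightarrow> fot t \<Longrightarrow> fot (\<lambda>e. opair (s e) (t e))"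
  unfolding opair_def by (intro fot_upair)

lemmas fo_intros = fo_const fo_not fo_conj fo_disj fo_imp fo_iff fo_all fo_ex fo_mem fo_eq
  fot_const fot_var fot_upair fot_opair

lemma fo_ex1:
  assumes "fo (\<lambda>e. P (e 0) (\<lambda>i. e (Suc i)))"
  shows "fo (\<lambda>e. \<exists>!x. P x e)"
  unfolding Ex1_def
  using assms fo_rename[OF assms, of "case_nat 0 (\<lambda>j. Suc (Suc j))"]
  by (intro fo_conj fo_ex fo_all fo_imp fo_eq fot_var) simp_all

text \<open>Separation needs a bounding set; for a class of subsets of \<open>a\<close> the power
  set is one.\<close>

lemma fo_subset_bound:
  assumes "fo (\<lambda>e. P (e 0))" "\<And>x. P x \<Longrightarrow> x \<^bold>\<subseteq> a"
  shows "\<exists>s. \<forall>x. x \<^bold>\<in> s \<longleftrightarrow> P x"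
proof -
  obtain p where "\<forall>z. z \<^bold>\<in> p \<longleftrightarrow> z \<^bold>\<subseteq> a" using power_set[of a] unfolding sub_def by blast
  then show ?thesis using fo_separation[OF assms(1), of p] assms(2) by metis
qed

definition cprod :: "'a::zf \<Rightarrow> 'a \<Rightarrow> 'a" where
  "cprod X Y = setof (\<lambda>p. \<exists>x y. x \<^bold>\<in> X \<and> y \<^bold>\<in> Y \<and> p = opair x y)"

lemma mem_cprod: "p \<^bold>\<in> cprod X Y \<longleftrightarrow> (\<exists>x y. x \<^bold>\<in> X \<and> y \<^bold>\<in> Y \<and> p = opair x y)"
proof -
  \<comment> \<open>The elements \<open>upair x x\<close> and \<open>upair x y\<close> of a pair are
    subsets of \<open>cup X Y\<close>, so the pair is a subset of the power set
    \<open>a\<close>.\<close>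
  obtain a where a: "\<forall>z. z \<^bold>\<in> a \<longleftrightarrow> z \<^bold>\<subseteq> cup X Y"
    using power_set[of "cup X Y"] unfolding sub_def by blast
  show ?thesis unfolding cprod_def
  proof (rule mem_setof[OF fo_subset_bound[of _ a]])
    show "fo (\<lambda>e. \<exists>x y. x \<^bold>\<in> X \<and> y \<^bold>\<in> Y \<and> e 0 = opair x y)"
      by (intro fo_intros)
  qed (auto simp: a sub_def opair_def)
qed

section \<open>Order isomorphisms\<close>

text \<open>With a relation in place of \<open>app\<close>, isomorphy stays first-order, and
  inverses, composites and gluings can be written as formulas. The last clause contains both
  functionality and injectivity.\<close>

definition riso :: "('a::zf \<Rightarrow> 'a \<Rightarrow> bool) \<Rightarrow> 'a \<Rightarrow> 'a \<Rightarrow> 'a \<Rightarrow> 'a \<Rightarrow> bool" where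
  "riso P X R Y S \<longleftrightarrow>
     (\<forall>x. x \<^bold>\<in> X \<longrightarrow> (\<exists>y. y \<^bold>\<in> Y \<and> P x y)) \<and>
     (\<forall>y. y \<^bold>\<in> Y \<longrightarrow> (\<exists>x. x \<^bold>\<in> X \<and> P x y)) \<and>
     (\<forall>x y x' y'. x \<^bold>\<in> X \<and> y \<^bold>\<in> Y \<and> x' \<^bold>\<in> X \<and> y' \<^bold>\<in> Y \<and> P x y \<and> P x' y' \<longrightarrow>
        (x = x' \<longleftrightarrow> y = y') \<and> (opair x x' \<^bold>\<in> R \<longleftrightarrow> opair y y' \<^bold>\<in> S))"

lemma func_app:
  assumes "func f A B" "a \<^bold>\<in> A"
  shows "opair a (app f a) \<^bold>\<in> f" "app f a \<^bold>\<in> B" "opair a b \<^bold>\<in> f \<longleftrightarrow> b = app f a"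
proof -
  have ex: "\<exists>!b. opair a b \<^bold>\<in> f" using assms unfolding func_def by blast
  from theI'[OF ex] show 1: "opair a (app f a) \<^bold>\<in> f" unfolding app_def .
  then obtain a' b' where "b' \<^bold>\<in> B" "opair a (app f a) = opair a' b'"
    using assms unfolding func_def by blast
  then show "app f a \<^bold>\<in> B" by auto
  show "opair a b \<^bold>\<in> f \<longleftrightarrow> b = app f a" using 1 ex by blast
qed

text \<open>The function is cut out of \<open>cprod X Y\<close> by Separation, which is where
  definability of \<open>P\<close> is needed.\<close>

lemma order_isoI:
  assumes P: "fo (\<lambda>e. P (e 0) (e 1))" and iso: "riso P X R Y S"
  shows "order_iso (X, R) (Y, S)"
proof -
  have P2: "fo (\<lambda>e. P (e 1) (e 0))"
    using fo_rename[OF P, of "\<lambda>i. if i = 0 then 1 else 0"] by simp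
  define f where "f = sep (cprod X Y) (\<lambda>p. \<exists>x y. p = opair x y \<and> P x y)"
  have "fo (\<lambda>e. \<exists>x y. e 0 = opair x y \<and> P x y)"
    using P2 by (intro fo_intros) simp
  then have f: "p \<^bold>\<in> f \<longleftrightarrow> (\<exists>x y. x \<^bold>\<in> X \<and> y \<^bold>\<in> Y \<and> p = opair x y \<and> P x y)" for p
    unfolding f_def by (subst mem_sep) (auto simp: mem_cprod)
  have fxy: "opair x y \<^bold>\<in> f \<longleftrightarrow> x \<^bold>\<in> X \<and> y \<^bold>\<in> Y \<and> P x y" for x y
    unfolding f by auto
  have fnc: "func f X Y"
    unfolding func_def using iso unfolding riso_def fxy by (auto simp: f) metis
  have app: "app f x \<^bold>\<in> Y" "P x (app f x)" if "x \<^bold>\<in> X" for x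
    using func_app[OF fnc that] fxy by auto
  show ?thesis
    unfolding order_iso_def split
  proof (intro exI[of _ f] conjI fnc allI impI)
    fix y assume y: "y \<^bold>\<in> Y"
    then obtain x where x: "x \<^bold>\<in> X" "P x y" using iso unfolding riso_def by blast
    have "opair x y \<^bold>\<in> f" using fxy x y by blast
    then have "app f x = y" using func_app(3)[OF fnc x(1), of y] by simp
    moreover have "x' = x" if "x' \<^bold>\<in> X" "app f x' = y" for x'
      using iso app[OF that(1)] that x y unfolding riso_def by blast
    ultimately show "\<exists>!x. x \<^bold>\<in> X \<and> app f x = y" using x by blast
  next
    fix x x' assume "x \<^bold>\<in> X \<and> x' \<^bold>\<in> X"
    then show "(opair x x' \<^bold>\<in> R) = (opair (app f x) (app f x') \<^bold>\<in> S)"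
      using iso app[of x] app[of x'] unfolding riso_def by blast
  qed
qed

lemma order_iso_iff: "order_iso (X, R) (Y, S) \<longleftrightarrow> (\<exists>f. riso (\<lambda>x y. opair x y \<^bold>\<in> f) X R Y S)"
proof
  assume "order_iso (X, R) (Y, S)"
  then obtain f where f: "func f X Y" "\<forall>y. y \<^bold>\<in> Y \<longrightarrow> (\<exists>!x. x \<^bold>\<in> X \<and> app f x = y)"
     "\<forall>x x'. x \<^bold>\<in> X \<and> x' \<^bold>\<in> X \<longrightarrow> (opair x x' \<^bold>\<in> R \<longleftrightarrow> opair (app f x) (app f x') \<^bold>\<in> S)"
    unfolding order_iso_def by auto
  have "riso (\<lambda>x y. opair x y \<^bold>\<in> f) X R Y S"
    unfolding riso_def
  proof (intro conjI allI impI)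
    fix x assume "x \<^bold>\<in> X"
    then show "\<exists>y. y \<^bold>\<in> Y \<and> opair x y \<^bold>\<in> f" using func_app[OF f(1)] by blast
  next
    fix y assume "y \<^bold>\<in> Y"
    then show "\<exists>x. x \<^bold>\<in> X \<and> opair x y \<^bold>\<in> f" using func_app[OF f(1)] f(2) by blast
  next
    fix x y x' y' assume a: "x \<^bold>\<in> X \<and> y \<^bold>\<in> Y \<and> x' \<^bold>\<in> X \<and> y' \<^bold>\<in> Y \<and> opair x y \<^bold>\<in> f \<and> opair x' y' \<^bold>\<in> f"
    then have "y = app f x" "y' = app f x'" using func_app(3)[OF f(1)] by auto
    then show "(x = x') = (y = y')" "(opair x x' \<^bold>\<in> R) = (opair y y' \<^bold>\<in> S)"
      using a f(2,3) by auto
  qed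
  then show "\<exists>f. riso (\<lambda>x y. opair x y \<^bold>\<in> f) X R Y S" by blast
next
  assume "\<exists>f. riso (\<lambda>x y. opair x y \<^bold>\<in> f) X R Y S"
  then obtain f where f: "riso (\<lambda>x y. opair x y \<^bold>\<in> f) X R Y S" by blast
  show "order_iso (X, R) (Y, S)" by (rule order_isoI[OF _ f]) (intro fo_intros)
qed

lemma order_iso_sym:
  assumes "order_iso (X, R) (Y, S)"
  shows "order_iso (Y, S) (X, R)"
proof -
  obtain f where f: "riso (\<lambda>x y. opair x y \<^bold>\<in> f) X R Y S" using assms order_iso_iff by blast
  have "riso (\<lambda>y x. opair x y \<^bold>\<in> f) Y S X R"
    using f unfolding riso_def by (intro conjI; blast)
  then show ?thesis by (rule order_isoI[rotated]) (intro fo_intros)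
qed

lemma order_iso_trans:
  assumes "order_iso (X, R) (Y, S)" "order_iso (Y, S) (Z, T)"
  shows "order_iso (X, R) (Z, T)"
proof -
  obtain f g where f: "riso (\<lambda>x y. opair x y \<^bold>\<in> f) X R Y S"
    and g: "riso (\<lambda>x y. opair x y \<^bold>\<in> g) Y S Z T" using assms order_iso_iff by blast
  show ?thesis
  proof (rule order_isoI[of "\<lambda>x z. \<exists>y. y \<^bold>\<in> Y \<and> opair x y \<^bold>\<in> f \<and> opair y z \<^bold>\<in> g"])
    show "fo (\<lambda>e. \<exists>y. y \<^bold>\<in> Y \<and> opair (e 0) y \<^bold>\<in> f \<and> opair y (e 1) \<^bold>\<in> g)"
      by (intro fo_intros)
    show "riso (\<lambda>x z. \<exists>y. y \<^bold>\<in> Y \<and> opair x y \<^bold>\<in> f \<and> opair y z \<^bold>\<in> g) X R Z T"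
      unfolding riso_def
    proof (intro conjI allI impI)
      fix x assume "x \<^bold>\<in> X"
      then show "\<exists>z. z \<^bold>\<in> Z \<and> (\<exists>y. y \<^bold>\<in> Y \<and> opair x y \<^bold>\<in> f \<and> opair y z \<^bold>\<in> g)"
        using f g unfolding riso_def by meson
    next
      fix z assume "z \<^bold>\<in> Z"
      then show "\<exists>x. x \<^bold>\<in> X \<and> (\<exists>y. y \<^bold>\<in> Y \<and> opair x y \<^bold>\<in> f \<and> opair y z \<^bold>\<in> g)"
        using f g unfolding riso_def by meson
    next
      fix x z x' z'
      assume "x \<^bold>\<in> X \<and> z \<^bold>\<in> Z \<and> x' \<^bold>\<in> X \<and> z' \<^bold>\<in> Z \<and>
        (\<exists>y. y \<^bold>\<in> Y \<and> opair x y \<^bold>\<in> f \<and> opair y z \<^bold>\<in> g) \<and>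
        (\<exists>y. y \<^bold>\<in> Y \<and> opair x' y \<^bold>\<in> f \<and> opair y z' \<^bold>\<in> g)"
      then obtain y y' where *: "x \<^bold>\<in> X" "z \<^bold>\<in> Z" "x' \<^bold>\<in> X" "z' \<^bold>\<in> Z" "y \<^bold>\<in> Y" "y' \<^bold>\<in> Y"
        "opair x y \<^bold>\<in> f" "opair y z \<^bold>\<in> g" "opair x' y' \<^bold>\<in> f" "opair y' z' \<^bold>\<in> g" by blast
      have "(x = x' \<longleftrightarrow> y = y') \<and> (opair x x' \<^bold>\<in> R \<longleftrightarrow> opair y y' \<^bold>\<in> S)"
        using f * unfolding riso_def by blast
      moreover have "(y = y' \<longleftrightarrow> z = z') \<and> (opair y y' \<^bold>\<in> S \<longleftrightarrow> opair z z' \<^bold>\<in> T)"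
        using g * unfolding riso_def by blast
      ultimately show "(x = x') = (z = z')" "(opair x x' \<^bold>\<in> R) = (opair z z' \<^bold>\<in> T)" by auto
    qed
  qed
qed

text \<open>A single isomorphism supplies the images of all subsets, which makes \<open>E\<close>
  monotone; separately chosen copies need not be nested.\<close>

lemma order_iso_sub:
  assumes "order_iso (X, R) (Y, S)"
  shows "\<exists>E. \<forall>U. U \<^bold>\<subseteq> X \<longrightarrow> E U \<^bold>\<subseteq> Y \<and> order_iso (U, R) (E U, S) \<and> (\<forall>W. W \<^bold>\<subseteq> U \<longrightarrow> E W \<^bold>\<subseteq> E U)"
proof -
  obtain f where f: "riso (\<lambda>x y. opair x y \<^bold>\<in> f) X R Y S" using assms order_iso_iff by blast
  define E where "E U = sep Y (\<lambda>y. \<exists>x. x \<^bold>\<in> U \<and> opair x y \<^bold>\<in> f)" for U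
  have E: "y \<^bold>\<in> E U \<longleftrightarrow> y \<^bold>\<in> Y \<and> (\<exists>x. x \<^bold>\<in> U \<and> opair x y \<^bold>\<in> f)" for y U
    unfolding E_def by (rule mem_sep) (intro fo_intros)
  have "order_iso (U, R) (E U, S)" if U: "U \<^bold>\<subseteq> X" for U
    unfolding order_iso_iff
  proof
    show "riso (\<lambda>x y. opair x y \<^bold>\<in> f) U R (E U) S"
      unfolding riso_def E
    proof (intro conjI allI impI)
      fix x assume "x \<^bold>\<in> U"
      then show "\<exists>y. (y \<^bold>\<in> Y \<and> (\<exists>x. x \<^bold>\<in> U \<and> opair x y \<^bold>\<in> f)) \<and> opair x y \<^bold>\<in> f"
        using f subD[OF U] unfolding riso_def by blast
    next
      fix x y x' y'
      assume "x \<^bold>\<in> U \<and> (y \<^bold>\<in> Y \<and> (\<exists>x. x \<^bold>\<in> U \<and> opair x y \<^bold>\<in> f)) \<and> x' \<^bold>\<in> U \<and>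
        (y' \<^bold>\<in> Y \<and> (\<exists>x. x \<^bold>\<in> U \<and> opair x y' \<^bold>\<in> f)) \<and> opair x y \<^bold>\<in> f \<and> opair x' y' \<^bold>\<in> f"
      then have "x \<^bold>\<in> X" "y \<^bold>\<in> Y" "x' \<^bold>\<in> X" "y' \<^bold>\<in> Y" "opair x y \<^bold>\<in> f" "opair x' y' \<^bold>\<in> f"
        using subD[OF U] by auto
      then show "(x = x') = (y = y')" "(opair x x' \<^bold>\<in> R) = (opair y y' \<^bold>\<in> S)"
        using f unfolding riso_def by blast+
    qed blast
  qed
  then show ?thesis by (intro exI[of _ E]) (auto simp: E sub_def)
qed

text \<open>Glue the isomorphism on \<open>U\<close> to the identity on \<open>V\<close>. All cross
  pairs have the orientation \<open>s\<close> before and after. This also forces disjointness: a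
  common element would give one pair opposite truth values.\<close>

lemma order_iso_cup:
  assumes "order_iso (U, R) (E, R)"
    and UV: "\<And>x y. x \<^bold>\<in> U \<Longrightarrow> y \<^bold>\<in> V \<Longrightarrow> (opair x y \<^bold>\<in> R \<longleftrightarrow> s) \<and> (opair y x \<^bold>\<in> R \<longleftrightarrow> \<not> s)"
    and EV: "\<And>x y. x \<^bold>\<in> E \<Longrightarrow> y \<^bold>\<in> V \<Longrightarrow> (opair x y \<^bold>\<in> R \<longleftrightarrow> s) \<and> (opair y x \<^bold>\<in> R \<longleftrightarrow> \<not> s)"
  shows "order_iso (cup U V, R) (cup E V, R)"
proof -
  obtain f where f: "riso (\<lambda>x y. opair x y \<^bold>\<in> f) U R E R" using assms(1) order_iso_iff by blast
  have UV': "x \<noteq> y" if "x \<^bold>\<in> U" "y \<^bold>\<in> V" for x y using UV[OF that] by auto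
  have EV': "x \<noteq> y" if "x \<^bold>\<in> E" "y \<^bold>\<in> V" for x y using EV[OF that] by auto
  let ?P = "\<lambda>x y. x \<^bold>\<in> U \<and> y \<^bold>\<in> E \<and> opair x y \<^bold>\<in> f \<or> x \<^bold>\<in> V \<and> x = y"
  show ?thesis
  proof (rule order_isoI[of ?P])
    show "fo (\<lambda>e. ?P (e 0) (e 1))" by (intro fo_intros)
    show "riso ?P (cup U V) R (cup E V) R"
      unfolding riso_def
    proof (intro conjI allI impI)
      fix x assume "x \<^bold>\<in> cup U V"
      then show "\<exists>y. y \<^bold>\<in> cup E V \<and> ?P x y" using f unfolding riso_def mem_cup by blast
    next
      fix y assume "y \<^bold>\<in> cup E V"
      then show "\<exists>x. x \<^bold>\<in> cup U V \<and> ?P x y" using f unfolding riso_def mem_cup by blast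
    next
      fix x y x' y'
      assume "x \<^bold>\<in> cup U V \<and> y \<^bold>\<in> cup E V \<and> x' \<^bold>\<in> cup U V \<and> y' \<^bold>\<in> cup E V \<and> ?P x y \<and> ?P x' y'"
      then consider "x \<^bold>\<in> U" "y \<^bold>\<in> E" "opair x y \<^bold>\<in> f" "x' \<^bold>\<in> U" "y' \<^bold>\<in> E" "opair x' y' \<^bold>\<in> f"
        | "x \<^bold>\<in> U" "y \<^bold>\<in> E" "x' \<^bold>\<in> V" "x' = y'"
        | "x \<^bold>\<in> V" "x = y" "x' \<^bold>\<in> U" "y' \<^bold>\<in> E"
        | "x \<^bold>\<in> V" "x = y" "x' \<^bold>\<in> V" "x' = y'" by blast
      then have "(x = x') = (y = y') \<and> (opair x x' \<^bold>\<in> R) = (opair y y' \<^bold>\<in> R)"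
      proof cases
        case 1 then show ?thesis using f unfolding riso_def by blast
      next
        case 2 then show ?thesis using UV[of x x'] EV[of y y'] UV' EV' by auto
      next
        case 3 then show ?thesis using UV[of x' x] EV[of y' y] UV' EV' by metis
      qed auto
      then show "(x = x') = (y = y')" "(opair x x' \<^bold>\<in> R) = (opair y y' \<^bold>\<in> R)" by auto
    qed
  qed
qed

section \<open>Branching of subsets of the lexicographic order\<close>

text \<open>Says \<open>x(\<gamma>) = 1\<close> by membership of a pair, because \<open>app\<close>
  is a description and not part of the language of formulas.\<close>

definition digit :: "'a::zf \<Rightarrow> 'a \<Rightarrow> bool" where
  "digit x \<gamma> \<longleftrightarrow> opair \<gamma> one \<^bold>\<in> x"

text \<open>For \<open>s = True\<close> this is the lexicographic order, for \<open>s = False\<close> its converse; it lets the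
  arguments for the left and the right side of a branch be given once.\<close>

definition lexs :: "'a::zf \<Rightarrow> bool \<Rightarrow> 'a \<Rightarrow> 'a \<Rightarrow> bool" where
  "lexs \<alpha> s x y \<longleftrightarrow> (\<exists>\<delta>. \<delta> \<^bold>\<in> \<alpha> \<and> (\<forall>\<gamma>. \<gamma> \<^bold>\<in> \<delta> \<longrightarrow> (digit x \<gamma> \<longleftrightarrow> digit y \<gamma>)) \<and>
     (digit x \<delta> \<longleftrightarrow> \<not> s) \<and> (digit y \<delta> \<longleftrightarrow> s))"

text \<open>Viewed in the binary tree, all of \<open>Y\<close> passes through one node of level
  \<open>\<delta>\<close>; \<open>agrs\<close> is the same for the next level.\<close>

definition agr :: "'a::zf \<Rightarrow> 'a \<Rightarrow> bool" where
  "agr \<delta> Y \<longleftrightarrow> (\<forall>x y. x \<^bold>\<in> Y \<and> y \<^bold>\<in> Y \<longrightarrow> (\<forall>\<gamma>. \<gamma> \<^bold>\<in> \<delta> \<longrightarrow> (digit x \<gamma> \<longleftrightarrow> digit y \<gamma>)))"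

definition agrs :: "'a::zf \<Rightarrow> 'a \<Rightarrow> bool" where
  "agrs \<delta> Y \<longleftrightarrow> agr \<delta> Y \<and> (\<forall>x y. x \<^bold>\<in> Y \<and> y \<^bold>\<in> Y \<longrightarrow> (digit x \<delta> \<longleftrightarrow> digit y \<delta>))"

definition spl :: "'a::zf \<Rightarrow> 'a \<Rightarrow> bool" where
  "spl \<delta> Y \<longleftrightarrow> agr \<delta> Y \<and> (\<exists>x y. x \<^bold>\<in> Y \<and> y \<^bold>\<in> Y \<and> digit x \<delta> \<and> \<not> digit y \<delta>)"

lemma lexs_flip: "lexs \<alpha> (\<not> s) x y \<longleftrightarrow> lexs \<alpha> s y x"
  unfolding lexs_def by (simp add: eq_commute conj_commute)

lemma agr_mono: "agr \<delta> Y \<Longrightarrow> Z \<^bold>\<subseteq> Y \<Longrightarrow> agr \<delta> Z"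
  unfolding agr_def sub_def by blast

lemma agrs_mono: "agrs \<delta> Y \<Longrightarrow> Z \<^bold>\<subseteq> Y \<Longrightarrow> agrs \<delta> Z"
  unfolding agrs_def agr_def sub_def by blast

lemma ordinal_trans: "ordinal \<alpha> \<Longrightarrow> \<delta> \<^bold>\<in> \<alpha> \<Longrightarrow> \<gamma> \<^bold>\<in> \<delta> \<Longrightarrow> \<gamma> \<^bold>\<in> \<alpha>"
  unfolding ordinal_def sub_def by blast

lemma ordinal_mem_trans:
  assumes "ordinal \<alpha>" "\<delta> \<^bold>\<in> \<alpha>" "\<gamma> \<^bold>\<in> \<delta>" "\<beta> \<^bold>\<in> \<gamma>"
  shows "\<beta> \<^bold>\<in> \<delta>"
proof -
  have "\<gamma> \<^bold>\<in> \<alpha>" "\<beta> \<^bold>\<in> \<alpha>" using assms ordinal_trans by blast+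
  then show ?thesis using assms unfolding ordinal_def by blast
qed

lemma ordinal_irrefl: "ordinal \<alpha> \<Longrightarrow> \<delta> \<^bold>\<in> \<alpha> \<Longrightarrow> \<not> \<delta> \<^bold>\<in> \<delta>"
  unfolding ordinal_def by blast

lemma ordinal_linear: "ordinal \<alpha> \<Longrightarrow> \<gamma> \<^bold>\<in> \<alpha> \<Longrightarrow> \<delta> \<^bold>\<in> \<alpha> \<Longrightarrow> \<gamma> \<^bold>\<in> \<delta> \<or> \<gamma> = \<delta> \<or> \<delta> \<^bold>\<in> \<gamma>"
  unfolding ordinal_def by blast

text \<open>Definability is essential: an ordinal of the model need not be well-founded from the
  point of view of HOL.\<close>

lemma ordinal_least:
  assumes \<alpha>: "ordinal \<alpha>" and P: "fo (\<lambda>e. P (e 0))" and "\<delta> \<^bold>\<in> \<alpha>" "P \<delta>"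
  shows "\<exists>\<epsilon>. \<epsilon> \<^bold>\<in> \<alpha> \<and> P \<epsilon> \<and> (\<forall>\<gamma>. \<gamma> \<^bold>\<in> \<epsilon> \<longrightarrow> \<not> P \<gamma>)"
proof -
  let ?X = "sep \<alpha> P"
  have "?X \<^bold>\<subseteq> \<alpha>" "\<exists>\<beta>. \<beta> \<^bold>\<in> ?X" using assms(3,4) by (auto simp: mem_sep[OF P] sub_def)
  then obtain \<epsilon> where "\<epsilon> \<^bold>\<in> ?X" "\<forall>\<gamma>. \<gamma> \<^bold>\<in> ?X \<longrightarrow> \<epsilon> = \<gamma> \<or> \<epsilon> \<^bold>\<in> \<gamma>"
    using \<alpha> unfolding ordinal_def by blast
  then have \<epsilon>: "\<epsilon> \<^bold>\<in> \<alpha>" "P \<epsilon>" "\<And>\<gamma>. \<gamma> \<^bold>\<in> \<alpha> \<Longrightarrow> P \<gamma> \<Longrightarrow> \<epsilon> = \<gamma> \<or> \<epsilon> \<^bold>\<in> \<gamma>"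
    unfolding mem_sep[OF P] by blast+
  have "\<not> P \<gamma>" if "\<gamma> \<^bold>\<in> \<epsilon>" for \<gamma>
  proof
    assume "P \<gamma>"
    moreover have "\<gamma> \<^bold>\<in> \<alpha>" using ordinal_trans[OF \<alpha> \<epsilon>(1) that] .
    ultimately have "\<epsilon> = \<gamma> \<or> \<epsilon> \<^bold>\<in> \<gamma>" using \<epsilon>(3) by blast
    then have "\<gamma> \<^bold>\<in> \<gamma>" using that ordinal_mem_trans[OF \<alpha> \<open>\<gamma> \<^bold>\<in> \<alpha>\<close> _ that] by blast
    then show False using ordinal_irrefl[OF \<alpha> \<open>\<gamma> \<^bold>\<in> \<alpha>\<close>] by blast
  qed
  then show ?thesis using \<epsilon> by blast
qed

text \<open>Of the halves of \<open>B\<close> at its first splitting level \<open>\<delta>\<close>, the lower one splits later than the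
  upper one.\<close>

definition late_low :: "'a::zf \<Rightarrow> 'a \<Rightarrow> bool" where
  "late_low \<alpha> B \<longleftrightarrow> (\<exists>\<delta> \<epsilon> U V. \<delta> \<^bold>\<in> \<alpha> \<and> \<epsilon> \<^bold>\<in> \<alpha> \<and> (\<forall>x. x \<^bold>\<in> B \<longleftrightarrow> x \<^bold>\<in> U \<or> x \<^bold>\<in> V) \<and> agr \<delta> B \<and>
     (\<exists>x. x \<^bold>\<in> U) \<and> (\<forall>x. x \<^bold>\<in> U \<longrightarrow> \<not> digit x \<delta>) \<and> (\<forall>x. x \<^bold>\<in> V \<longrightarrow> digit x \<delta>) \<and>
     spl \<epsilon> V \<and> agrs \<epsilon> U)"

text \<open>\<open>H\<close> is a candidate for a homogeneous set and \<open>(A, S)\<close>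
  represents \<open>\<tau>\<close>; \<open>doubling\<close> is what
  \<open>\<tau> + \<tau> \<le> \<tau>\<close> yields inside each copy of \<open>\<tau>\<close> in
  \<open>H\<close>.\<close>

locale lex_copies =
  fixes \<alpha> A S R H :: "'a::zf"
  assumes \<alpha>: "ordinal \<alpha>"
    and digits_eq: "\<And>x y. x \<^bold>\<in> H \<Longrightarrow> y \<^bold>\<in> H \<Longrightarrow> (\<And>\<gamma>. \<gamma> \<^bold>\<in> \<alpha> \<Longrightarrow> digit x \<gamma> \<longleftrightarrow> digit y \<gamma>) \<Longrightarrow> x = y"
    and R_iff: "\<And>x y. x \<^bold>\<in> H \<Longrightarrow> y \<^bold>\<in> H \<Longrightarrow> opair x y \<^bold>\<in> R \<longleftrightarrow> lexs \<alpha> True x y"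
    and nonempty: "\<exists>a. a \<^bold>\<in> A"
    and iso_H: "order_iso (A, S) (H, R)"
    and doubling: "\<And>K. K \<^bold>\<subseteq> H \<Longrightarrow> order_iso (A, S) (K, R) \<Longrightarrow>
      \<exists>K1 K2. K1 \<^bold>\<subseteq> K \<and> K2 \<^bold>\<subseteq> K \<and> order_iso (A, S) (K1, R) \<and> order_iso (A, S) (K2, R) \<and>
        (\<forall>x y. x \<^bold>\<in> K1 \<and> y \<^bold>\<in> K2 \<longrightarrow> lexs \<alpha> True x y)"
begin

definition copy :: "'a \<Rightarrow> bool" where
  "copy K \<longleftrightarrow> K \<^bold>\<subseteq> H \<and> order_iso (A, S) (K, R)"

definition big :: "'a \<Rightarrow> bool" where
  "big K \<longleftrightarrow> (\<exists>Z. Z \<^bold>\<subseteq> K \<and> copy Z)"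

lemma fo_copy: "fot t \<Longrightarrow> fo (\<lambda>e. copy (t e))"
  by (rule fo_subst[where P = "\<lambda>x e. copy x"])
    (unfold copy_def order_iso_iff riso_def sub_def, intro fo_intros)

lemma fo_big: "fot t \<Longrightarrow> fo (\<lambda>e. big (t e))"
  by (rule fo_subst[where P = "\<lambda>x e. big x"])
    (unfold big_def sub_def, intro fo_intros fo_copy)

lemma lexs_asym: "lexs \<alpha> s x y \<Longrightarrow> \<not> lexs \<alpha> s y x"
  unfolding lexs_def using ordinal_linear[OF \<alpha>] by metis

lemma lexs_trans:
  assumes "lexs \<alpha> s x y" "lexs \<alpha> s y z"
  shows "lexs \<alpha> s x z"
proof -
  obtain \<gamma> where g: "\<gamma> \<^bold>\<in> \<alpha>" "\<forall>\<eta>. \<eta> \<^bold>\<in> \<gamma> \<longrightarrow> (digit x \<eta> \<longleftrightarrow> digit y \<eta>)" "digit x \<gamma> \<longleftrightarrow> \<not> s" "digit y \<gamma> \<longleftrightarrow> s"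
    using assms(1) unfolding lexs_def by blast
  obtain \<delta> where d: "\<delta> \<^bold>\<in> \<alpha>" "\<forall>\<eta>. \<eta> \<^bold>\<in> \<delta> \<longrightarrow> (digit y \<eta> \<longleftrightarrow> digit z \<eta>)" "digit y \<delta> \<longleftrightarrow> \<not> s" "digit z \<delta> \<longleftrightarrow> s"
    using assms(2) unfolding lexs_def by blast
  have "\<gamma> \<noteq> \<delta>" using g d by blast
  then consider "\<gamma> \<^bold>\<in> \<delta>" | "\<delta> \<^bold>\<in> \<gamma>" using ordinal_linear[OF \<alpha> g(1) d(1)] by blast
  then show ?thesis
  proof cases
    case 1
    then show ?thesis unfolding lexs_def using g d ordinal_mem_trans[OF \<alpha> d(1) 1]
      by (intro exI[of _ \<gamma>]) blast
  next
    case 2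
    then show ?thesis unfolding lexs_def using g d ordinal_mem_trans[OF \<alpha> g(1) 2]
      by (intro exI[of _ \<delta>]) blast
  qed
qed

lemma lexs_total:
  assumes "x \<^bold>\<in> H" "y \<^bold>\<in> H" "x \<noteq> y"
  shows "lexs \<alpha> True x y \<or> lexs \<alpha> True y x"
proof -
  let ?P = "\<lambda>\<delta>. digit x \<delta> \<noteq> digit y \<delta>"
  have 1: "fo (\<lambda>e. ?P (e 0))" unfolding digit_def by (intro fo_intros)
  obtain \<delta> where d: "\<delta> \<^bold>\<in> \<alpha>" "?P \<delta>" using digits_eq[OF assms(1,2)] assms(3) by blast
  obtain \<epsilon> where "\<epsilon> \<^bold>\<in> \<alpha>" "?P \<epsilon>" "\<forall>\<gamma>. \<gamma> \<^bold>\<in> \<epsilon> \<longrightarrow> \<not> ?P \<gamma>"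
    using ordinal_least[of \<alpha> ?P \<delta>, OF \<alpha> 1 d] by blast
  then show ?thesis unfolding lexs_def by (cases "digit x \<epsilon>") auto
qed

lemma copy_H: "copy H"
  using iso_H sub_refl unfolding copy_def by blast

lemma copy_sub: "copy K \<Longrightarrow> K \<^bold>\<subseteq> H"
  unfolding copy_def by blast

lemma copy_big: "copy K \<Longrightarrow> big K"
  unfolding big_def using sub_refl by blast

lemma copy_nonempty: "copy K \<Longrightarrow> \<exists>x. x \<^bold>\<in> K"
  using nonempty unfolding copy_def order_iso_iff riso_def by blast

lemma copy_double:
  assumes "copy K"
  shows "\<exists>K1 K2. K1 \<^bold>\<subseteq> K \<and> K2 \<^bold>\<subseteq> K \<and> copy K1 \<and> copy K2 \<and>
    (\<forall>x y. x \<^bold>\<in> K1 \<and> y \<^bold>\<in> K2 \<longrightarrow> lexs \<alpha> s x y)"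
proof -
  have "\<exists>K1 K2. K1 \<^bold>\<subseteq> K \<and> K2 \<^bold>\<subseteq> K \<and> copy K1 \<and> copy K2 \<and>
    (\<forall>x y. x \<^bold>\<in> K1 \<and> y \<^bold>\<in> K2 \<longrightarrow> lexs \<alpha> True x y)"
    using assms doubling[of K] sub_trans unfolding copy_def by meson
  then show ?thesis using lexs_flip[of \<alpha> True] by (cases s) (simp, simp, blast)
qed

lemma R_cross:
  assumes "x \<^bold>\<in> H" "y \<^bold>\<in> H" "lexs \<alpha> s x y"
  shows "(opair x y \<^bold>\<in> R \<longleftrightarrow> s) \<and> (opair y x \<^bold>\<in> R \<longleftrightarrow> \<not> s)"
  using assms R_iff lexs_asym lexs_flip[of \<alpha> True] by (cases s) auto

text \<open>The exchange step. All of \<open>cup U V\<close> is isomorphic to a copy inside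
  \<open>W\<close>; the image of \<open>U\<close> there is isomorphic to \<open>U\<close> and, by
  \<open>cWV\<close>, lies on the same side of \<open>V\<close>. A copy inside \<open>U\<close> is
  carried along, so bigness survives.\<close>

lemma copy_replace:
  assumes UV: "copy (cup U V)" and W: "big W"
    and cUV: "\<And>x y. x \<^bold>\<in> U \<Longrightarrow> y \<^bold>\<in> V \<Longrightarrow> lexs \<alpha> s x y"
    and cWV: "\<And>x y. x \<^bold>\<in> W \<Longrightarrow> y \<^bold>\<in> V \<Longrightarrow> lexs \<alpha> s x y"
  obtains E where "E \<^bold>\<subseteq> W" "copy (cup E V)" "big U \<Longrightarrow> big E"
proof -
  obtain Z where Z: "Z \<^bold>\<subseteq> W" "copy Z" using W unfolding big_def by blast
  have "order_iso (cup U V, R) (Z, R)"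
    using UV Z order_iso_sym order_iso_trans unfolding copy_def by blast
  from order_iso_sub[OF this] obtain E where
    E: "\<And>X. X \<^bold>\<subseteq> cup U V \<Longrightarrow> E X \<^bold>\<subseteq> Z \<and> order_iso (X, R) (E X, R) \<and> (\<forall>W. W \<^bold>\<subseteq> X \<longrightarrow> E W \<^bold>\<subseteq> E X)"
    by blast
  have U: "U \<^bold>\<subseteq> cup U V" by (rule subI) simp
  have EW: "E U \<^bold>\<subseteq> W" using E[OF U] Z sub_trans by blast
  have EH: "E U \<^bold>\<subseteq> H" using E[OF U] Z copy_sub sub_trans by blast
  have UH: "U \<^bold>\<subseteq> H" "V \<^bold>\<subseteq> H" using copy_sub[OF UV] unfolding sub_def by auto
  have "order_iso (cup U V, R) (cup (E U) V, R)"
  proof (rule order_iso_cup)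
    show "order_iso (U, R) (E U, R)" using E[OF U] by blast
  next
    fix x y assume "x \<^bold>\<in> U" "y \<^bold>\<in> V"
    then show "(opair x y \<^bold>\<in> R \<longleftrightarrow> s) \<and> (opair y x \<^bold>\<in> R \<longleftrightarrow> \<not> s)"
      using R_cross cUV UH subD by metis
  next
    fix x y assume "x \<^bold>\<in> E U" "y \<^bold>\<in> V"
    then show "(opair x y \<^bold>\<in> R \<longleftrightarrow> s) \<and> (opair y x \<^bold>\<in> R \<longleftrightarrow> \<not> s)"
      using R_cross cWV UH EH EW subD by metis
  qed
  then have "order_iso (A, S) (cup (E U) V, R)" using UV order_iso_trans unfolding copy_def by blast
  then have c: "copy (cup (E U) V)" using EH UH unfolding copy_def sub_def by simp
  have b: "big (E U)" if bigU: "big U"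
  proof -
    obtain Y where Y: "Y \<^bold>\<subseteq> U" "copy Y" using bigU unfolding big_def by blast
    have "E Y \<^bold>\<subseteq> E U" using E[OF U] Y by blast
    moreover have "order_iso (A, S) (E Y, R)"
      using E[OF sub_trans[OF Y(1) U]] Y order_iso_trans unfolding copy_def by blast
    ultimately show ?thesis using EH sub_trans unfolding big_def copy_def by blast
  qed
  show thesis using that[OF EW c b] .
qed

section \<open>First splitting levels of copies\<close>

lemma spl_exists:
  assumes "\<delta> \<^bold>\<in> \<alpha>" "x \<^bold>\<in> K" "y \<^bold>\<in> K" "digit x \<delta>" "\<not> digit y \<delta>"
  shows "\<exists>\<epsilon>. \<epsilon> \<^bold>\<in> \<alpha> \<and> spl \<epsilon> K"
proof -
  let ?P = "\<lambda>\<delta>. \<exists>x y. x \<^bold>\<in> K \<and> y \<^bold>\<in> K \<and> digit x \<delta> \<and> \<not> digit y \<delta>"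
  have 1: "?P \<delta>" using assms by blast
  have 2: "fo (\<lambda>e. ?P (e 0))"
    unfolding digit_def by (intro fo_intros)
  obtain \<epsilon> where \<epsilon>: "\<epsilon> \<^bold>\<in> \<alpha>" "?P \<epsilon>" "\<forall>\<gamma>. \<gamma> \<^bold>\<in> \<epsilon> \<longrightarrow> \<not> ?P \<gamma>"
    using ordinal_least[of \<alpha> ?P \<delta>, OF \<alpha> 2 assms(1) 1] by blast
  have "spl \<epsilon> K" unfolding spl_def agr_def using \<epsilon>(2,3) by blast
  then show ?thesis using \<epsilon>(1) by blast
qed

lemma big_splits:
  assumes "big K"
  shows "\<exists>\<delta>. \<delta> \<^bold>\<in> \<alpha> \<and> spl \<delta> K"
proof -
  obtain Z where Z: "Z \<^bold>\<subseteq> K" "copy Z" using assms unfolding big_def by blast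
  obtain K1 K2 where K12: "K1 \<^bold>\<subseteq> Z" "K2 \<^bold>\<subseteq> Z" "copy K1" "copy K2"
    "\<forall>x y. x \<^bold>\<in> K1 \<and> y \<^bold>\<in> K2 \<longrightarrow> lexs \<alpha> True x y" using copy_double[OF Z(2), of True] by blast
  obtain x y where xy: "x \<^bold>\<in> K1" "y \<^bold>\<in> K2"
    using copy_nonempty[OF K12(3)] copy_nonempty[OF K12(4)] by blast
  then have "lexs \<alpha> True x y" using K12(5) by blast
  then obtain \<delta> where \<delta>: "\<delta> \<^bold>\<in> \<alpha>" "\<not> digit x \<delta>" "digit y \<delta>" unfolding lexs_def by auto
  show ?thesis
    by (rule spl_exists[OF \<delta>(1) _ _ \<delta>(3,2)])
      (rule subD[OF Z(1) subD[OF K12(2) xy(2)]], rule subD[OF Z(1) subD[OF K12(1) xy(1)]])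
qed

lemma lexs_digit_mono:
  assumes "lexs \<alpha> True x y" "\<delta> \<^bold>\<in> \<alpha>" "\<And>\<gamma>. \<gamma> \<^bold>\<in> \<delta> \<Longrightarrow> digit x \<gamma> \<longleftrightarrow> digit y \<gamma>" "digit x \<delta>"
  shows "digit y \<delta>"
proof -
  obtain \<epsilon> where \<epsilon>: "\<epsilon> \<^bold>\<in> \<alpha>" "\<And>\<gamma>. \<gamma> \<^bold>\<in> \<epsilon> \<Longrightarrow> digit x \<gamma> \<longleftrightarrow> digit y \<gamma>" "\<not> digit x \<epsilon>" "digit y \<epsilon>"
    using assms(1) unfolding lexs_def by auto
  from ordinal_linear[OF \<alpha> \<epsilon>(1) assms(2)] show ?thesis
    using \<epsilon> assms(3,4) by auto
qed

text \<open>On a set whose elements agree below \<open>\<delta>\<close>, the digit at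
  \<open>\<delta>\<close> is monotone. Hence of two copies, one below the other, either the upper
  has only ones there or the lower has only zeros.\<close>

lemma copy_half:
  assumes K: "copy K" and \<delta>: "\<delta> \<^bold>\<in> \<alpha>" "agr \<delta> K"
  obtains K' where "K' \<^bold>\<subseteq> K" "copy K'" "agrs \<delta> K'"
proof -
  obtain K1 K2 where K12: "K1 \<^bold>\<subseteq> K" "K2 \<^bold>\<subseteq> K" "copy K1" "copy K2"
    "\<And>x y. x \<^bold>\<in> K1 \<Longrightarrow> y \<^bold>\<in> K2 \<Longrightarrow> lexs \<alpha> True x y" using copy_double[OF K, of True] by blast
  show thesis
  proof (cases "\<exists>x. x \<^bold>\<in> K1 \<and> digit x \<delta>")
    case True
    then obtain x where x: "x \<^bold>\<in> K1" "digit x \<delta>" by blast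
    have "digit y \<delta>" if "y \<^bold>\<in> K2" for y
      using lexs_digit_mono[OF K12(5)[OF x(1) that] \<delta>(1) _ x(2)] \<delta>(2) x that K12(1,2)
      unfolding agr_def sub_def by blast
    then show ?thesis using that[OF K12(2,4)] agr_mono[OF \<delta>(2) K12(2)] unfolding agrs_def by blast
  next
    case False
    then show ?thesis using that[OF K12(1,3)] agr_mono[OF \<delta>(2) K12(1)] unfolding agrs_def by blast
  qed
qed

text \<open>If no node has copies on both sides, the nodes above which there is a copy form a branch \<open>b\<close>
  with domain \<open>D\<close>. The elements of a copy leave \<open>b\<close> to the left, or to the right, or not at all, and
  by doubling one of the three occurs for all elements of some copy. Each is impossible; for the
  first two, minimise a bound on the levels at which a copy leaves \<open>b\<close>.\<close>

lemma copy_branches: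
  assumes K0: "copy K0"
  shows "\<exists>\<delta> U V. \<delta> \<^bold>\<in> \<alpha> \<and> U \<^bold>\<subseteq> K0 \<and> V \<^bold>\<subseteq> K0 \<and> copy U \<and> copy V \<and>
    (\<forall>x y \<gamma>. x \<^bold>\<in> U \<and> y \<^bold>\<in> V \<and> \<gamma> \<^bold>\<in> \<delta> \<longrightarrow> (digit x \<gamma> \<longleftrightarrow> digit y \<gamma>)) \<and>
    (\<forall>x. x \<^bold>\<in> U \<longrightarrow> \<not> digit x \<delta>) \<and> (\<forall>y. y \<^bold>\<in> V \<longrightarrow> digit y \<delta>)"
proof (rule ccontr)
  assume "\<not> ?thesis"
  then have no: False if "\<delta> \<^bold>\<in> \<alpha>" "U \<^bold>\<subseteq> K0" "V \<^bold>\<subseteq> K0" "copy U" "copy V"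
    "\<And>x y \<gamma>. x \<^bold>\<in> U \<Longrightarrow> y \<^bold>\<in> V \<Longrightarrow> \<gamma> \<^bold>\<in> \<delta> \<Longrightarrow> digit x \<gamma> \<longleftrightarrow> digit y \<gamma>"
    "\<And>x. x \<^bold>\<in> U \<Longrightarrow> \<not> digit x \<delta>" "\<And>y. y \<^bold>\<in> V \<Longrightarrow> digit y \<delta>" for \<delta> U V
    using that by blast
  \<comment> \<open>At the least level where elements of \<open>K\<close> and \<open>K'\<close>
    disagree, each of the two copies has a constant digit and the digits differ: a node with copies
    on both sides, which \<open>no\<close> excludes.\<close>
  have same: "digit x \<eta> \<longleftrightarrow> digit y \<eta>"
    if K: "copy K" "K \<^bold>\<subseteq> K0" "agrs \<gamma> K" and K': "copy K'" "K' \<^bold>\<subseteq> K0" "agrs \<gamma> K'"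
      and \<gamma>: "\<gamma> \<^bold>\<in> \<alpha>" and xy: "x \<^bold>\<in> K" "y \<^bold>\<in> K'" and \<eta>: "\<eta> \<^bold>\<in> \<gamma> \<or> \<eta> = \<gamma>" for K K' \<gamma> \<eta> x y
  proof (rule ccontr)
    assume ne: "\<not> ?thesis"
    let ?P = "\<lambda>\<eta>. \<exists>x y. x \<^bold>\<in> K \<and> y \<^bold>\<in> K' \<and> digit x \<eta> \<noteq> digit y \<eta>"
    have "fo (\<lambda>e. ?P (e 0))" unfolding digit_def by (intro fo_intros)
    moreover have \<eta>\<alpha>: "\<eta> \<^bold>\<in> \<alpha>" using \<eta> \<gamma> ordinal_trans[OF \<alpha>] by blast
    moreover have "?P \<eta>" using ne xy by blast
    ultimately obtain \<epsilon> where \<epsilon>: "\<epsilon> \<^bold>\<in> \<alpha>" "?P \<epsilon>" "\<forall>\<gamma>. \<gamma> \<^bold>\<in> \<epsilon> \<longrightarrow> \<not> ?P \<gamma>"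
      using ordinal_least[OF \<alpha>, of ?P] by blast
    then obtain u v where uv: "u \<^bold>\<in> K" "v \<^bold>\<in> K'" "digit u \<epsilon> \<noteq> digit v \<epsilon>" by blast
    have "\<not> \<eta> \<^bold>\<in> \<epsilon>" using \<epsilon>(3) \<open>?P \<eta>\<close> by blast
    then have "\<epsilon> \<^bold>\<in> \<gamma> \<or> \<epsilon> = \<gamma>"
      using \<eta> ordinal_linear[OF \<alpha> \<epsilon>(1) \<eta>\<alpha>] ordinal_mem_trans[OF \<alpha> \<gamma>] by blast
    then have c: "digit z \<epsilon> = digit u \<epsilon>" if "z \<^bold>\<in> K" for z
      using K(3) that uv unfolding agrs_def agr_def by blast
    have c': "digit z \<epsilon> = digit v \<epsilon>" if "z \<^bold>\<in> K'" for z
      using \<open>\<epsilon> \<^bold>\<in> \<gamma> \<or> \<epsilon> = \<gamma>\<close> K'(3) that uv unfolding agrs_def agr_def by blast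
    show False
    proof (cases "digit u \<epsilon>")
      case True
      then show ?thesis using no[OF \<epsilon>(1) K'(2) K(2) K'(1) K(1)] \<epsilon>(3) c c' uv by blast
    next
      case False
      then show ?thesis using no[OF \<epsilon>(1) K(2) K'(2) K(1) K'(1)] \<epsilon>(3) c c' uv by blast
    qed
  qed
  \<comment> \<open>By \<open>same\<close>, the digit \<open>b \<gamma>\<close> does not depend on
    the copy that witnesses it; outside \<open>D\<close> it is false.\<close>
  define D where "D \<gamma> \<longleftrightarrow> (\<exists>K. copy K \<and> K \<^bold>\<subseteq> K0 \<and> agrs \<gamma> K)" for \<gamma>
  define b where "b \<gamma> \<longleftrightarrow> (\<exists>K. copy K \<and> K \<^bold>\<subseteq> K0 \<and> agrs \<gamma> K \<and> (\<forall>x. x \<^bold>\<in> K \<longrightarrow> digit x \<gamma>))" for \<gamma>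
  have D_down: "D \<gamma>" if h: "D \<epsilon>" "\<epsilon> \<^bold>\<in> \<alpha>" "\<gamma> \<^bold>\<in> \<epsilon>" for \<gamma> \<epsilon>
  proof -
    obtain K where K: "copy K" "K \<^bold>\<subseteq> K0" "agrs \<epsilon> K" using h(1) unfolding D_def by blast
    have "agrs \<gamma> K"
      using K(3) h(3) ordinal_mem_trans[OF \<alpha> h(2,3)] unfolding agrs_def agr_def by blast
    then show ?thesis using K unfolding D_def by blast
  qed
  have fo_D: "fo (\<lambda>e. D (t e))" if "fot t" for t
    by (rule fo_subst[where P = "\<lambda>x e. D x", OF _ that])
      (unfold D_def sub_def agrs_def agr_def digit_def, intro fo_intros fo_copy)
  have fo_b: "fo (\<lambda>e. b (t e))" if "fot t" for t
    by (rule fo_subst[where P = "\<lambda>x e. b x", OF _ that])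
      (unfold b_def sub_def agrs_def agr_def digit_def, intro fo_intros fo_copy)
  have b_eq: "digit x \<gamma> \<longleftrightarrow> b \<gamma>"
    if "copy K" "K \<^bold>\<subseteq> K0" "agrs \<gamma> K" "\<gamma> \<^bold>\<in> \<alpha>" "x \<^bold>\<in> K" for K \<gamma> x
  proof
    assume "digit x \<gamma>"
    then have "\<forall>y. y \<^bold>\<in> K \<longrightarrow> digit y \<gamma>" using that unfolding agrs_def by blast
    then show "b \<gamma>" unfolding b_def using that by blast
  next
    assume "b \<gamma>"
    then obtain K' where K': "copy K'" "K' \<^bold>\<subseteq> K0" "agrs \<gamma> K'" "\<forall>x. x \<^bold>\<in> K' \<longrightarrow> digit x \<gamma>"
      unfolding b_def by blast
    obtain y where "y \<^bold>\<in> K'" using copy_nonempty K' by blast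
    then show "digit x \<gamma>" using same[OF that(1-3) K'(1-3) that(4,5), of y \<gamma>] K' by blast
  qed
  \<comment> \<open>A copy that follows \<open>b\<close> throughout splits first at some
    \<open>\<delta>\<close>, yet a subcopy agrees through \<open>\<delta>\<close>. So
    \<open>\<delta>\<close> lies in \<open>D\<close>, and following \<open>b\<close> there forbids
    the splitting.\<close>
  have M: False if Z: "copy Z" "Z \<^bold>\<subseteq> K0"
    "\<And>x \<gamma>. x \<^bold>\<in> Z \<Longrightarrow> \<gamma> \<^bold>\<in> \<alpha> \<Longrightarrow> D \<gamma> \<Longrightarrow> digit x \<gamma> \<longleftrightarrow> b \<gamma>" for Z
  proof -
    obtain \<delta> where \<delta>: "\<delta> \<^bold>\<in> \<alpha>" "spl \<delta> Z" using big_splits[OF copy_big[OF Z(1)]] by blast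
    then obtain K' where "K' \<^bold>\<subseteq> Z" "copy K'" "agrs \<delta> K'"
      using copy_half[OF Z(1)] unfolding spl_def by blast
    then have "D \<delta>" unfolding D_def using Z sub_trans by blast
    then show False using Z(3) \<delta> unfolding spl_def by blast
  qed
  \<comment> \<open>\<open>x\<close> leaves \<open>b\<close> at \<open>\<gamma>\<close>, to the left
    for \<open>s = True\<close> and to the right for \<open>s = False\<close>.\<close>
  define lev where "lev s \<gamma> x \<longleftrightarrow> \<gamma> \<^bold>\<in> \<alpha> \<and> D \<gamma> \<and> (\<forall>\<eta>. \<eta> \<^bold>\<in> \<gamma> \<longrightarrow> (digit x \<eta> \<longleftrightarrow> b \<eta>)) \<and>
    (digit x \<gamma> \<longleftrightarrow> \<not> s) \<and> (b \<gamma> \<longleftrightarrow> s)" for s \<gamma> x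
  \<comment> \<open>Of two elements leaving on the same side, the one nearer to the branch does not
    leave earlier.\<close>
  have lev_mono: "\<not> \<gamma>' \<^bold>\<in> \<gamma>" if "lev s \<gamma> x" "lev s \<gamma>' y" "lexs \<alpha> s x y" for s \<gamma> \<gamma>' x y
  proof
    assume g: "\<gamma>' \<^bold>\<in> \<gamma>"
    have "\<forall>\<eta>. \<eta> \<^bold>\<in> \<gamma>' \<longrightarrow> (digit y \<eta> \<longleftrightarrow> digit x \<eta>)"
      using g that ordinal_mem_trans[OF \<alpha>] unfolding lev_def by blast
    moreover have "digit x \<gamma>' \<longleftrightarrow> s" "digit y \<gamma>' \<longleftrightarrow> \<not> s" using g that unfolding lev_def by blast+
    ultimately have "lexs \<alpha> s y x" unfolding lexs_def using that(2)[unfolded lev_def] by blast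
    then show False using that(3) lexs_asym by blast
  qed
  define bd where "bd s \<epsilon> \<longleftrightarrow> (\<exists>K. copy K \<and> K \<^bold>\<subseteq> K0 \<and>
    (\<forall>x. x \<^bold>\<in> K \<longrightarrow> (\<exists>\<gamma>. lev s \<gamma> x \<and> (\<gamma> \<^bold>\<in> \<epsilon> \<or> \<gamma> = \<epsilon>))))" for s \<epsilon>
  \<comment> \<open>After doubling, any element of the part nearer to the branch bounds the leaving
    levels of the other part.\<close>
  have bd: "\<exists>\<epsilon> y. y \<^bold>\<in> Z \<and> lev s \<epsilon> y \<and> bd s \<epsilon>"
    if Z: "copy Z" "Z \<^bold>\<subseteq> K0" "\<And>x. x \<^bold>\<in> Z \<Longrightarrow> \<exists>\<gamma>. lev s \<gamma> x" for Z s
  proof -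
    obtain K1 K2 where K12: "K1 \<^bold>\<subseteq> Z" "K2 \<^bold>\<subseteq> Z" "copy K1" "copy K2"
      "\<And>x y. x \<^bold>\<in> K1 \<Longrightarrow> y \<^bold>\<in> K2 \<Longrightarrow> lexs \<alpha> s x y" using copy_double[OF Z(1), of s] by blast
    obtain y where y: "y \<^bold>\<in> K2" using copy_nonempty K12 by blast
    then have yZ: "y \<^bold>\<in> Z" using K12 subD by blast
    then obtain \<epsilon> where \<epsilon>: "lev s \<epsilon> y" using Z by blast
    have "\<exists>\<gamma>. lev s \<gamma> x \<and> (\<gamma> \<^bold>\<in> \<epsilon> \<or> \<gamma> = \<epsilon>)" if x: "x \<^bold>\<in> K1" for x
    proof -
      obtain \<gamma> where \<gamma>: "lev s \<gamma> x" using x K12 Z subD by blast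
      have "\<not> \<epsilon> \<^bold>\<in> \<gamma>" using lev_mono[OF \<gamma> \<epsilon> K12(5)[OF x y]] .
      then show ?thesis using \<gamma> \<epsilon> ordinal_linear[OF \<alpha>] unfolding lev_def by blast
    qed
    then have "bd s \<epsilon>" unfolding bd_def using K12 Z sub_trans by blast
    then show ?thesis using yZ \<epsilon> by blast
  qed
  have side: False
    if Z: "copy Z" "Z \<^bold>\<subseteq> K0" "\<And>x. x \<^bold>\<in> Z \<Longrightarrow> \<exists>\<gamma>. lev s \<gamma> x" for Z s
  proof -
    have fobd: "fo (\<lambda>e. bd s (e 0))"
      unfolding bd_def lev_def sub_def digit_def by (intro fo_intros fo_copy fo_D fo_b)
    from bd[OF Z] obtain \<epsilon>0 where "\<epsilon>0 \<^bold>\<in> \<alpha>" "bd s \<epsilon>0" unfolding lev_def by blast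
    from ordinal_least[OF \<alpha> fobd this] obtain \<epsilon> where
      \<epsilon>: "\<epsilon> \<^bold>\<in> \<alpha>" "bd s \<epsilon>" "\<And>\<gamma>. \<gamma> \<^bold>\<in> \<epsilon> \<Longrightarrow> \<not> bd s \<gamma>" by blast
    then obtain K where K: "copy K" "K \<^bold>\<subseteq> K0"
      "\<And>x. x \<^bold>\<in> K \<Longrightarrow> \<exists>\<gamma>. lev s \<gamma> x \<and> (\<gamma> \<^bold>\<in> \<epsilon> \<or> \<gamma> = \<epsilon>)" unfolding bd_def by blast
    obtain K1 K2 where K12: "K1 \<^bold>\<subseteq> K" "K2 \<^bold>\<subseteq> K" "copy K1" "copy K2"
      "\<And>x y. x \<^bold>\<in> K1 \<Longrightarrow> y \<^bold>\<in> K2 \<Longrightarrow> lexs \<alpha> s x y" using copy_double[OF K(1), of s] by blast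
    have sub: "K1 \<^bold>\<subseteq> K0" "K2 \<^bold>\<subseteq> K0" using K12 K sub_trans by blast+
    \<comment> \<open>If the bound is attained in the farther part \<open>K1\<close>, all of
      \<open>K2\<close> leaves exactly at \<open>\<epsilon>\<close>, hence agrees through
      \<open>\<epsilon>\<close> and must follow \<open>b\<close> there. Otherwise all of
      \<open>K1\<close> leaves below \<open>\<epsilon>\<close>, and doubling \<open>K1\<close> gives
      a smaller bound.\<close>
    show False
    proof (cases "\<exists>x. x \<^bold>\<in> K1 \<and> lev s \<epsilon> x")
      case True
      then obtain x where x: "x \<^bold>\<in> K1" "lev s \<epsilon> x" by blast
      have y: "lev s \<epsilon> y" if "y \<^bold>\<in> K2" for y
        using K(3)[OF subD[OF K12(2) that]] lev_mono[OF x(2) _ K12(5)[OF x(1) that]] by blast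
      then have "agrs \<epsilon> K2" unfolding agrs_def agr_def lev_def by blast
      then have "digit y \<epsilon> \<longleftrightarrow> b \<epsilon>" if "y \<^bold>\<in> K2" for y
        using b_eq[OF K12(4) sub(2) _ \<epsilon>(1) that] by blast
      then show ?thesis using y copy_nonempty[OF K12(4)] unfolding lev_def by blast
    next
      case False
      have l: "\<exists>\<gamma>. lev s \<gamma> x" if "x \<^bold>\<in> K1" for x using K(3) K12(1) subD that by blast
      obtain \<gamma> y where y: "y \<^bold>\<in> K1" "lev s \<gamma> y" "bd s \<gamma>" using bd[OF K12(3) sub(1) l] by blast
      obtain \<gamma>' where \<gamma>': "lev s \<gamma>' y" "\<gamma>' \<^bold>\<in> \<epsilon>" using K(3)[OF subD[OF K12(1) y(1)]] False y(1) by blast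
      have "\<gamma>' = \<gamma>" using y(2) \<gamma>'(1) ordinal_linear[OF \<alpha>, of \<gamma> \<gamma>'] unfolding lev_def by blast
      then show ?thesis using \<epsilon>(3) \<gamma>' y by blast
    qed
  qed
  have tri: "(\<forall>\<gamma>. \<gamma> \<^bold>\<in> \<alpha> \<and> D \<gamma> \<longrightarrow> (digit x \<gamma> \<longleftrightarrow> b \<gamma>)) \<or> (\<exists>\<gamma>. lev True \<gamma> x) \<or> (\<exists>\<gamma>. lev False \<gamma> x)" for x
  proof (rule ccontr)
    assume n: "\<not> ?thesis"
    let ?P = "\<lambda>\<gamma>. D \<gamma> \<and> (digit x \<gamma> \<noteq> b \<gamma>)"
    have "fo (\<lambda>e. ?P (e 0))" unfolding digit_def by (intro fo_intros fo_D fo_b)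
    then obtain \<epsilon> where \<epsilon>: "\<epsilon> \<^bold>\<in> \<alpha>" "?P \<epsilon>" "\<And>\<gamma>. \<gamma> \<^bold>\<in> \<epsilon> \<Longrightarrow> \<not> ?P \<gamma>"
      using ordinal_least[OF \<alpha>, of ?P] n by blast
    have "digit x \<gamma> \<longleftrightarrow> b \<gamma>" if "\<gamma> \<^bold>\<in> \<epsilon>" for \<gamma>
      using \<epsilon>(3)[OF that] D_down[OF _ \<epsilon>(1) that] \<epsilon>(2) by blast
    then have "lev (b \<epsilon>) \<epsilon> x" using \<epsilon> unfolding lev_def by blast
    then show False using n by (cases "b \<epsilon>") auto
  qed
  have on: "\<not> lev s \<gamma> y"
    if "\<forall>\<gamma>. \<gamma> \<^bold>\<in> \<alpha> \<and> D \<gamma> \<longrightarrow> (digit x \<gamma> \<longleftrightarrow> b \<gamma>)" "lexs \<alpha> s x y" for s x y \<gamma>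
  proof
    assume l: "lev s \<gamma> y"
    have "digit y \<eta> \<longleftrightarrow> digit x \<eta>" if \<eta>: "\<eta> \<^bold>\<in> \<gamma>" for \<eta>
      using l \<eta> D_down[of \<gamma> \<eta>] ordinal_trans[OF \<alpha> _ \<eta>] \<open>\<forall>\<gamma>. _\<close> unfolding lev_def by blast
    moreover have "\<gamma> \<^bold>\<in> \<alpha>" "digit y \<gamma> \<longleftrightarrow> \<not> s" "digit x \<gamma> \<longleftrightarrow> s" using l that(1) unfolding lev_def by blast+
    ultimately have "lexs \<alpha> s y x" unfolding lexs_def by blast
    then show False using that(2) lexs_asym by blast
  qed
  have off: "\<not> lev True \<gamma> y" if l': "lev False \<gamma>' x" and "lexs \<alpha> True x y" for x y \<gamma> \<gamma>'
  proof
    assume l: "lev True \<gamma> y"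
    have "\<gamma> \<noteq> \<gamma>'" using l l' unfolding lev_def by blast
    then consider "\<gamma> \<^bold>\<in> \<gamma>'" | "\<gamma>' \<^bold>\<in> \<gamma>" using l l' ordinal_linear[OF \<alpha>] unfolding lev_def by blast
    then have "lexs \<alpha> True y x"
    proof cases
      case 1
      then show ?thesis using l l' ordinal_mem_trans[OF \<alpha> _ 1] unfolding lexs_def lev_def by blast
    next
      case 2
      then show ?thesis using l l' ordinal_mem_trans[OF \<alpha> _ 2] unfolding lexs_def lev_def by blast
    qed
    then show False using that(2) lexs_asym by blast
  qed
  have ndesc: "\<not> lev True \<gamma> y" if "\<not> (\<exists>\<gamma>. lev True \<gamma> x)" "lexs \<alpha> True x y" for x y \<gamma>
    using tri[of x] on[of x True y \<gamma>] off[of _ x y \<gamma>] that by blast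
  have on': "\<not> lev False \<gamma> x"
    if "\<forall>\<gamma>. \<gamma> \<^bold>\<in> \<alpha> \<and> D \<gamma> \<longrightarrow> (digit y \<gamma> \<longleftrightarrow> b \<gamma>)" "lexs \<alpha> True x y" for x y \<gamma>
    using on[OF that(1), of False x] that(2) lexs_flip[of \<alpha> True] by simp
  \<comment> \<open>Three copies in increasing order: some element of \<open>K1\<close> does not
    leave to the left, hence nothing in \<open>K2\<close> or \<open>K3\<close> does. Some element of
    \<open>K3\<close> does not leave to the right either, so it follows \<open>b\<close>, and
    nothing below it leaves to the right. The middle copy \<open>K2\<close> thus follows
    \<open>b\<close>, against \<open>M\<close>.\<close>
  obtain K1 K' where K1: "K1 \<^bold>\<subseteq> K0" "K' \<^bold>\<subseteq> K0" "copy K1" "copy K'"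
    "\<forall>x y. x \<^bold>\<in> K1 \<and> y \<^bold>\<in> K' \<longrightarrow> lexs \<alpha> True x y" using copy_double[OF K0, of True] by blast
  obtain K2 K3 where K2: "K2 \<^bold>\<subseteq> K'" "K3 \<^bold>\<subseteq> K'" "copy K2" "copy K3"
    "\<forall>x y. x \<^bold>\<in> K2 \<and> y \<^bold>\<in> K3 \<longrightarrow> lexs \<alpha> True x y" using copy_double[OF K1(4), of True] by blast
  have sub: "K2 \<^bold>\<subseteq> K0" "K3 \<^bold>\<subseteq> K0" using K2(1,2) K1(2) sub_trans by blast+
  obtain x where x: "x \<^bold>\<in> K1" "\<not> (\<exists>\<gamma>. lev True \<gamma> x)" using side[OF K1(3,1), of True] by blast
  have nT: "\<not> lev True \<gamma> y" if "y \<^bold>\<in> K'" for y \<gamma> using ndesc[OF x(2)] K1(5) x(1) that by blast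
  obtain z where z: "z \<^bold>\<in> K3" "\<not> (\<exists>\<gamma>. lev False \<gamma> z)" using side[OF K2(4) sub(2), of False] by blast
  have zon: "\<forall>\<gamma>. \<gamma> \<^bold>\<in> \<alpha> \<and> D \<gamma> \<longrightarrow> (digit z \<gamma> \<longleftrightarrow> b \<gamma>)"
    using tri[of z] nT[OF subD[OF K2(2) z(1)]] z(2) by blast
  have "\<not> lev False \<gamma> y" if "y \<^bold>\<in> K2" for y \<gamma> using on'[OF zon] K2(5) z(1) that by blast
  then have "\<forall>\<gamma>. \<gamma> \<^bold>\<in> \<alpha> \<and> D \<gamma> \<longrightarrow> (digit y \<gamma> \<longleftrightarrow> b \<gamma>)" if "y \<^bold>\<in> K2" for y
    using tri[of y] nT[OF subD[OF K2(1) that]] that by blast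
  then show False using M[OF K2(3) sub(1)] by blast
qed

text \<open>A copy splitting at \<open>\<delta>\<close> into two big halves. \<open>U\<close> is the
  half to be altered, the lower one for \<open>s = True\<close>; \<open>V\<close> is the half kept
  fixed.\<close>

definition good :: "bool \<Rightarrow> 'a \<Rightarrow> 'a \<Rightarrow> 'a \<Rightarrow> bool" where
  "good s \<delta> U V \<longleftrightarrow> \<delta> \<^bold>\<in> \<alpha> \<and> agr \<delta> (cup U V) \<and> (\<forall>x. x \<^bold>\<in> U \<longrightarrow> (digit x \<delta> \<longleftrightarrow> \<not> s)) \<and>
     (\<forall>x. x \<^bold>\<in> V \<longrightarrow> (digit x \<delta> \<longleftrightarrow> s)) \<and> copy (cup U V) \<and> big U \<and> big V"

lemma cup_commute: "cup U V = cup V U"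
  by (rule set_eqI) auto

lemma good_flip: "good s \<delta> U V \<Longrightarrow> good (\<not> s) \<delta> V U"
  unfolding good_def by (simp add: cup_commute[of V U])

lemma big_nonempty: "big K \<Longrightarrow> \<exists>x. x \<^bold>\<in> K"
  unfolding big_def using copy_nonempty subD by blast

text \<open>Copies \<open>X\<close> and \<open>Y\<close> on the two sides of a node do not make
  \<open>cup X Y\<close> a copy. So \<open>X\<close> is cut into an initial and a final part, both
  big, and the final part is carried into \<open>Y\<close>.\<close>

lemma good_exists:
  assumes K: "copy K"
  shows "\<exists>\<delta> U V. good s \<delta> U V \<and> U \<^bold>\<subseteq> K \<and> V \<^bold>\<subseteq> K"
proof -
  obtain \<delta> X Y where \<delta>: "\<delta> \<^bold>\<in> \<alpha>" and XY: "X \<^bold>\<subseteq> K" "Y \<^bold>\<subseteq> K" "copy X" "copy Y"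
    and ag: "\<forall>x y \<gamma>. x \<^bold>\<in> X \<and> y \<^bold>\<in> Y \<and> \<gamma> \<^bold>\<in> \<delta> \<longrightarrow> (digit x \<gamma> \<longleftrightarrow> digit y \<gamma>)"
    and bX: "\<forall>x. x \<^bold>\<in> X \<longrightarrow> \<not> digit x \<delta>" and bY: "\<forall>y. y \<^bold>\<in> Y \<longrightarrow> digit y \<delta>"
    using copy_branches[OF K] by blast
  obtain K1 K2 where K12: "K1 \<^bold>\<subseteq> X" "K2 \<^bold>\<subseteq> X" "copy K1" "copy K2"
    "\<forall>x y. x \<^bold>\<in> K1 \<and> y \<^bold>\<in> K2 \<longrightarrow> lexs \<alpha> True x y" using copy_double[OF XY(3), of True] by blast
  \<comment> \<open>The cut is placed just below \<open>K2\<close>: the elements below all of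
    \<open>K2\<close> form \<open>X0\<close>, which contains \<open>K1\<close>; the rest,
    \<open>X1\<close>, contains \<open>K2\<close>.\<close>
  define P where "P x \<longleftrightarrow> (\<exists>y. y \<^bold>\<in> K2 \<and> \<not> lexs \<alpha> True x y)" for x
  have P: "fo (\<lambda>e. P (e 0))" unfolding P_def lexs_def digit_def by (intro fo_intros)
  have P': "fo (\<lambda>e. \<not> P (e 0))" by (intro fo_not P)
  define X0 where "X0 = sep X (\<lambda>x. \<not> P x)"
  define X1 where "X1 = sep X P"
  have X0: "x \<^bold>\<in> X0 \<longleftrightarrow> x \<^bold>\<in> X \<and> \<not> P x" for x unfolding X0_def by (rule mem_sep[OF P'])
  have X1: "x \<^bold>\<in> X1 \<longleftrightarrow> x \<^bold>\<in> X \<and> P x" for x unfolding X1_def by (rule mem_sep[OF P])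
  have "K1 \<^bold>\<subseteq> X0" using subD[OF K12(1)] K12(5) unfolding sub_def X0 P_def by blast
  then have big0: "big X0" unfolding big_def using K12(3) by blast
  have "K2 \<^bold>\<subseteq> X1" using subD[OF K12(2)] lexs_asym unfolding sub_def X1 P_def by blast
  then have big1: "big X1" unfolding big_def using K12(4) by blast
  have bigY: "big Y" using copy_big[OF XY(4)] .
  have "cup X1 X0 = X" by (rule set_eqI) (auto simp: X0 X1)
  then have cX: "copy (cup X1 X0)" using XY(3) by simp
  have cross: "lexs \<alpha> True x y" if "x \<^bold>\<in> X" "y \<^bold>\<in> Y" for x y
    unfolding lexs_def using that \<delta> ag bX bY by (intro exI[of _ \<delta>]) blast
  have 1: "lexs \<alpha> False x y" if x: "x \<^bold>\<in> X1" and y: "y \<^bold>\<in> X0" for x y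
  proof -
    obtain z where z: "z \<^bold>\<in> K2" "\<not> lexs \<alpha> True x z" using x unfolding X1 P_def by blast
    have yz: "lexs \<alpha> True y z" using y z(1) unfolding X0 P_def by blast
    have H: "x \<^bold>\<in> H" "y \<^bold>\<in> H" "z \<^bold>\<in> H"
      using x y subD[OF K12(2) z(1)] subD[OF copy_sub[OF XY(3)]] unfolding X0 X1 by blast+
    have "x \<noteq> y" using yz z(2) by blast
    then have "lexs \<alpha> True x y \<or> lexs \<alpha> True y x" by (rule lexs_total[OF H(1,2)])
    moreover have "\<not> lexs \<alpha> True x y" using lexs_trans[of True x y z] yz z(2) by blast
    ultimately show ?thesis using lexs_flip[of \<alpha> True] by simp
  qed
  have 2: "lexs \<alpha> False x y" if "x \<^bold>\<in> Y" "y \<^bold>\<in> X0" for x y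
    using cross[of y x] that lexs_flip[of \<alpha> True] unfolding X0 by simp
  \<comment> \<open>The part exchanged is the upper one, hence the orientation
    \<open>False\<close>.\<close>
  obtain E where E: "E \<^bold>\<subseteq> Y" "copy (cup E X0)" "big X1 \<longrightarrow> big E"
    using copy_replace[OF cX bigY 1 2] by blast
  have "agr \<delta> (cup X0 E)"
  proof -
    obtain x0 y0 where xy0: "x0 \<^bold>\<in> X" "y0 \<^bold>\<in> Y" using copy_nonempty[OF XY(3)] copy_nonempty[OF XY(4)] by blast
    have "digit x \<gamma> \<longleftrightarrow> digit x0 \<gamma>" if "x \<^bold>\<in> X \<or> x \<^bold>\<in> Y" "\<gamma> \<^bold>\<in> \<delta>" for x \<gamma>
      using that ag xy0 by blast
    then show ?thesis unfolding agr_def mem_cup X0 using subD[OF E(1)] by blast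
  qed
  then have g: "good True \<delta> X0 E"
    unfolding good_def using \<delta> E(2,3) big0 big1 bX bY subD[OF E(1)] cup_commute[of X0 E]
    by (auto simp: X0)
  have "X0 \<^bold>\<subseteq> K" "E \<^bold>\<subseteq> K" using XY(1,2) E(1) unfolding sub_def X0 by blast+
  then show ?thesis using g good_flip[OF g] by (cases s) auto
qed

lemma good_lexs:
  assumes "good s \<delta> U V" "x \<^bold>\<in> U" "y \<^bold>\<in> V"
  shows "lexs \<alpha> s x y"
  unfolding lexs_def using assms unfolding good_def agr_def mem_cup
  by (intro exI[of _ \<delta>]) blast

text \<open>Take \<open>V\<close> splitting as early as possible, at \<open>\<epsilon>\<close>. Copies inside \<open>U\<close> then contain copies all of
  whose elements agree up to and including \<open>\<epsilon>\<close>; shrinking \<open>U\<close> into such a copy reverses the order of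
  the two splitting levels.\<close>

lemma good_reversed:
  "\<exists>\<delta> U V \<epsilon>. good s \<delta> U V \<and> \<epsilon> \<^bold>\<in> \<alpha> \<and> spl \<epsilon> V \<and> agrs \<epsilon> U"
proof -
  let ?P = "\<lambda>\<epsilon>. \<exists>\<delta> U V. good s \<delta> U V \<and> spl \<epsilon> V"
  have fo_good: "fo (\<lambda>e. ?P (e 0))"
  proof -
    \<comment> \<open>The union is named by a quantified set \<open>W\<close>, which turns the
      predicate into a first-order one.\<close>
    have eq: "good s \<delta> U V \<longleftrightarrow> (\<exists>W. (\<forall>x. x \<^bold>\<in> W \<longleftrightarrow> x \<^bold>\<in> U \<or> x \<^bold>\<in> V) \<and> \<delta> \<^bold>\<in> \<alpha> \<and> agr \<delta> W \<and>
        (\<forall>x. x \<^bold>\<in> U \<longrightarrow> (digit x \<delta> \<longleftrightarrow> \<not> s)) \<and>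
        (\<forall>x. x \<^bold>\<in> V \<longrightarrow> (digit x \<delta> \<longleftrightarrow> s)) \<and> copy W \<and> big U \<and> big V)" for \<delta> U V
    proof -
      have "(\<forall>x. x \<^bold>\<in> W \<longleftrightarrow> x \<^bold>\<in> U \<or> x \<^bold>\<in> V) \<longleftrightarrow> W = cup U V" for W
        by (auto intro: set_eqI)
      then show ?thesis unfolding good_def by simp
    qed
    show ?thesis unfolding eq spl_def agr_def digit_def by (intro fo_intros fo_copy fo_big)
  qed
  obtain \<delta>0 U0 V0 where g0: "good s \<delta>0 U0 V0" using good_exists[OF copy_H] by blast
  obtain \<epsilon>0 where e0: "\<epsilon>0 \<^bold>\<in> \<alpha>" "spl \<epsilon>0 V0"
    using big_splits[of V0] g0 unfolding good_def by blast
  have P0: "?P \<epsilon>0" using g0 e0 by blast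
  obtain \<epsilon> where \<epsilon>: "\<epsilon> \<^bold>\<in> \<alpha>" "?P \<epsilon>" "\<forall>\<gamma>. \<gamma> \<^bold>\<in> \<epsilon> \<longrightarrow> \<not> ?P \<gamma>"
    using ordinal_least[of \<alpha> ?P \<epsilon>0, OF \<alpha> fo_good e0(1) P0] by blast
  obtain \<delta> U V where g: "good s \<delta> U V" and V: "spl \<epsilon> V" using \<epsilon>(2) by blast
  obtain Z where Z: "Z \<^bold>\<subseteq> U" "copy Z" using g unfolding good_def big_def by blast
  \<comment> \<open>This configuration inside \<open>U\<close> serves to supply \<open>C1\<close>:
    as a second half it is subject to the minimality of \<open>\<epsilon>\<close>, so it does not
    split before \<open>\<epsilon>\<close>.\<close>
  obtain \<delta>1 C0 C1 where C: "good s \<delta>1 C0 C1" "C0 \<^bold>\<subseteq> Z" "C1 \<^bold>\<subseteq> Z" using good_exists[OF Z(2)] by blast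
  have bigC: "big C1" using C(1) unfolding good_def by blast
  obtain \<epsilon>1 where e1: "\<epsilon>1 \<^bold>\<in> \<alpha>" "spl \<epsilon>1 C1"
    using big_splits[OF bigC] by blast
  have "\<not> \<epsilon>1 \<^bold>\<in> \<epsilon>" using \<epsilon>(3) e1(2) C(1) by blast
  then have "\<epsilon> \<^bold>\<in> \<epsilon>1 \<or> \<epsilon> = \<epsilon>1" using ordinal_linear[OF \<alpha> \<epsilon>(1) e1(1)] by blast
  then have agrC: "agr \<epsilon> C1"
    using e1(2) ordinal_mem_trans[OF \<alpha> e1(1)] unfolding spl_def agr_def by blast
  obtain Y where Y: "Y \<^bold>\<subseteq> C1" "copy Y" using bigC unfolding big_def by blast
  obtain D where D: "D \<^bold>\<subseteq> Y" "copy D" "agrs \<epsilon> D"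
    using copy_half[OF Y(2) \<epsilon>(1) agr_mono[OF agrC Y(1)]] by blast
  have DU: "D \<^bold>\<subseteq> U" using D(1) Y(1) C(3) Z(1) sub_trans by blast
  have bigD: "big D" using copy_big[OF D(2)] .
  have cUV: "copy (cup U V)" and bigU: "big U" using g unfolding good_def by blast+
  have 1: "lexs \<alpha> s x y" if "x \<^bold>\<in> D" "y \<^bold>\<in> V" for x y
    by (rule good_lexs[OF g subD[OF DU that(1)] that(2)])
  obtain E where E: "E \<^bold>\<subseteq> D" "copy (cup E V)" "big U \<longrightarrow> big E"
    using copy_replace[OF cUV bigD good_lexs[OF g] 1] by blast
  have EU: "E \<^bold>\<subseteq> U" using E(1) DU sub_trans by blast
  have EV: "cup E V \<^bold>\<subseteq> cup U V" using EU unfolding sub_def mem_cup by blast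
  have "agr \<delta> (cup E V)" using agr_mono[OF _ EV] g unfolding good_def by blast
  then have "good s \<delta> E V"
    using g E(2,3) bigU subD[OF EU] unfolding good_def by blast
  moreover have "agrs \<epsilon> E" using agrs_mono[OF D(3) E(1)] .
  ultimately show ?thesis using \<epsilon>(1) V by blast
qed

text \<open>The witnesses in \<open>late_low\<close> are forced: a set has only one first splitting
  level, and the digits there determine the halves. This is what allows the negation of
  \<open>late_low\<close> to be proved.\<close>

lemma late_low_good:
  assumes g: "good True \<delta> U V" and l: "late_low \<alpha> (cup U V)"
  shows "\<exists>\<epsilon>. \<epsilon> \<^bold>\<in> \<alpha> \<and> spl \<epsilon> V \<and> agrs \<epsilon> U"
  using l unfolding late_low_def
proof (elim exE conjE)
  fix \<delta>' \<epsilon> U' V' w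
  assume d': "\<delta>' \<^bold>\<in> \<alpha>" and e: "\<epsilon> \<^bold>\<in> \<alpha>"
    and W: "\<forall>x. x \<^bold>\<in> cup U V \<longleftrightarrow> x \<^bold>\<in> U' \<or> x \<^bold>\<in> V'"
    and ag: "agr \<delta>' (cup U V)" and w: "w \<^bold>\<in> U'" and bU: "\<forall>x. x \<^bold>\<in> U' \<longrightarrow> \<not> digit x \<delta>'"
    and bV: "\<forall>x. x \<^bold>\<in> V' \<longrightarrow> digit x \<delta>'" and sp: "spl \<epsilon> V'" "agrs \<epsilon> U'"
  have d: "\<delta> \<^bold>\<in> \<alpha>" and ag0: "agr \<delta> (cup U V)" and b0: "\<forall>x. x \<^bold>\<in> U \<longrightarrow> \<not> digit x \<delta>" "\<forall>x. x \<^bold>\<in> V \<longrightarrow> digit x \<delta>"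
    and big: "big U" "big V"
    using g unfolding good_def by simp_all
  obtain u v where uv: "u \<^bold>\<in> U" "v \<^bold>\<in> V" using big_nonempty[OF big(1)] big_nonempty[OF big(2)] by blast
  obtain w' where w': "w' \<^bold>\<in> V'" using sp(1) unfolding spl_def by blast
  have "\<not> \<delta> \<^bold>\<in> \<delta>'"
    using ag[unfolded agr_def, rule_format, of u v \<delta>] uv b0 by auto
  moreover have "\<not> \<delta>' \<^bold>\<in> \<delta>"
    using ag0[unfolded agr_def, rule_format, of w w' \<delta>'] W[rule_format, of w] W[rule_format, of w']
      w w' bU bV by blast
  ultimately have eq: "\<delta>' = \<delta>" using ordinal_linear[OF \<alpha> d d'] by blast
  have "x \<^bold>\<in> U' \<longleftrightarrow> x \<^bold>\<in> U" "x \<^bold>\<in> V' \<longleftrightarrow> x \<^bold>\<in> V" for x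
    using W[unfolded mem_cup, rule_format, of x] b0[rule_format, of x] bU[unfolded eq, rule_format, of x]
      bV[unfolded eq, rule_format, of x] by blast+
  then have "U' = U" "V' = V" by (blast intro: set_eqI)+
  then show ?thesis using e sp by blast
qed

lemma late_low_not_constant:
  "\<exists>B B'. copy B \<and> copy B' \<and> late_low \<alpha> B \<and> \<not> late_low \<alpha> B'"
proof -
  obtain \<delta> U V \<epsilon> where g: "good True \<delta> U V" and "\<epsilon> \<^bold>\<in> \<alpha>" "spl \<epsilon> V" "agrs \<epsilon> U"
    using good_reversed[of True] by blast
  moreover have "\<exists>x. x \<^bold>\<in> U" using g big_nonempty unfolding good_def by blast
  ultimately have 1: "late_low \<alpha> (cup U V)"
    unfolding late_low_def good_def
    by (intro exI[of _ \<delta>] exI[of _ \<epsilon>] exI[of _ U] exI[of _ V]) auto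
  have 2: "copy (cup U V)" using g unfolding good_def by blast
  \<comment> \<open>With \<open>False\<close>, \<open>U'\<close> is the upper half, so it is the
    lower half \<open>V'\<close> that splits first, at \<open>\<epsilon>'\<close>.\<close>
  obtain \<delta>' U' V' \<epsilon>' where g': "good False \<delta>' U' V'" and e': "\<epsilon>' \<^bold>\<in> \<alpha>" "spl \<epsilon>' V'" "agrs \<epsilon>' U'"
    using good_reversed[of False] by blast
  have g'': "good True \<delta>' V' U'" using good_flip[OF g'] by simp
  have "\<not> late_low \<alpha> (cup V' U')"
  proof
    assume "late_low \<alpha> (cup V' U')"
    then obtain \<eta> where h: "\<eta> \<^bold>\<in> \<alpha>" "spl \<eta> U'" "agrs \<eta> V'" using late_low_good[OF g''] by blast
    have "\<not> \<eta> \<^bold>\<in> \<epsilon>'" "\<eta> \<noteq> \<epsilon>'" using h(2) e'(3) unfolding spl_def agrs_def agr_def by blast+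
    moreover have "\<not> \<epsilon>' \<^bold>\<in> \<eta>" using h(3) e'(2) unfolding spl_def agrs_def agr_def by blast
    ultimately show False using ordinal_linear[OF \<alpha> h(1) e'(1)] by blast
  qed
  moreover have "copy (cup V' U')" using g'' unfolding good_def by blast
  ultimately show ?thesis using 1 2 by blast
qed

end

section \<open>The colouring\<close>

lemma fo_func:
  assumes "fot f"
  shows "fo (\<lambda>e. func (f e) A B)"
  by (rule fo_subst[where P = "\<lambda>x e. func x A B", OF _ assms], unfold func_def)
    (intro fo_intros fo_ex1)

lemma mem_seqs2: "x \<^bold>\<in> seqs2 \<alpha> \<longleftrightarrow> func x \<alpha> two"
  unfolding seqs2_def
proof (rule mem_setof[OF fo_subset_bound[of _ "cprod \<alpha> two"]])
  show "fo (\<lambda>e. func (e 0) \<alpha> two)" by (intro fo_func fot_var)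
  show "x \<^bold>\<subseteq> cprod \<alpha> two" if "func x \<alpha> two" for x
    using that unfolding func_def sub_def mem_cprod by blast
qed

lemma app_digit:
  assumes "func x \<alpha> two" "\<delta> \<^bold>\<in> \<alpha>"
  shows "app x \<delta> = (if digit x \<delta> then one else emptyset)"
proof -
  have "digit x \<delta> \<longleftrightarrow> one = app x \<delta>" unfolding digit_def by (rule func_app(3)[OF assms])
  moreover have "app x \<delta> = emptyset \<or> app x \<delta> = one" using func_app(2)[OF assms] by simp
  ultimately show ?thesis by auto
qed

lemma seqs2_eqI:
  assumes "func x \<alpha> two" "func y \<alpha> two" "\<And>\<gamma>. \<gamma> \<^bold>\<in> \<alpha> \<Longrightarrow> digit x \<gamma> \<longleftrightarrow> digit y \<gamma>"
  shows "x = y"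
proof -
  have *: "p \<^bold>\<in> v" if u: "func u \<alpha> two" and v: "func v \<alpha> two" and p: "p \<^bold>\<in> u"
    and uv: "\<And>\<gamma>. \<gamma> \<^bold>\<in> \<alpha> \<Longrightarrow> digit u \<gamma> \<longleftrightarrow> digit v \<gamma>" for p u v
  proof -
    obtain a b where ab: "a \<^bold>\<in> \<alpha>" "p = opair a b" using u p unfolding func_def by blast
    then have "b = app u a" using func_app(3)[OF u ab(1)] p by simp
    also have "\<dots> = app v a" using app_digit[OF u ab(1)] app_digit[OF v ab(1)] uv[OF ab(1)] by simp
    finally show ?thesis using func_app(1)[OF v ab(1)] ab(2) by simp
  qed
  show ?thesis by (rule set_eqI) (use *[OF assms(1,2)] *[OF assms(2,1)] assms(3) in blast)
qed

lemma lex_less_iff: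
  assumes \<alpha>: "ordinal \<alpha>" and x: "func x \<alpha> two" and y: "func y \<alpha> two"
  shows "lex_less \<alpha> x y \<longleftrightarrow> lexs \<alpha> True x y"
proof -
  have 1: "app x \<gamma> = app y \<gamma> \<longleftrightarrow> (digit x \<gamma> \<longleftrightarrow> digit y \<gamma>)" if "\<gamma> \<^bold>\<in> \<alpha>" for \<gamma>
    using app_digit[OF x that] app_digit[OF y that] by simp
  have 2: "app x \<gamma> \<^bold>\<in> app y \<gamma> \<longleftrightarrow> \<not> digit x \<gamma> \<and> digit y \<gamma>" if "\<gamma> \<^bold>\<in> \<alpha>" for \<gamma>
    using app_digit[OF x that] app_digit[OF y that] by simp
  have 3: "(\<forall>\<gamma>. \<gamma> \<^bold>\<in> \<delta> \<longrightarrow> app x \<gamma> = app y \<gamma>) \<longleftrightarrow> (\<forall>\<gamma>. \<gamma> \<^bold>\<in> \<delta> \<longrightarrow> (digit x \<gamma> \<longleftrightarrow> digit y \<gamma>))"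
    if "\<delta> \<^bold>\<in> \<alpha>" for \<delta> using 1 ordinal_trans[OF \<alpha> that] by blast
  have "\<delta> \<^bold>\<in> \<alpha> \<and> app x \<delta> \<noteq> app y \<delta> \<and> (\<forall>\<gamma>. \<gamma> \<^bold>\<in> \<delta> \<longrightarrow> app x \<gamma> = app y \<gamma>) \<and> app x \<delta> \<^bold>\<in> app y \<delta> \<longleftrightarrow>
      \<delta> \<^bold>\<in> \<alpha> \<and> (\<forall>\<gamma>. \<gamma> \<^bold>\<in> \<delta> \<longrightarrow> (digit x \<gamma> \<longleftrightarrow> digit y \<gamma>)) \<and> (digit x \<delta> \<longleftrightarrow> \<not> True) \<and> (digit y \<delta> \<longleftrightarrow> True)" for \<delta>
    using 1[of \<delta>] 2[of \<delta>] 3[of \<delta>] by blast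
  then show ?thesis unfolding lex_less_def lexs_def by simp
qed

text \<open>\<open>lex_less\<close> is stated with \<open>app\<close>, so Separation is applied to
  the equivalent \<open>lexs\<close>.\<close>

lemma mem_lex_order:
  assumes \<alpha>: "ordinal \<alpha>" and "x \<^bold>\<in> seqs2 \<alpha>" "y \<^bold>\<in> seqs2 \<alpha>"
  shows "opair x y \<^bold>\<in> lex_order \<alpha> \<longleftrightarrow> lexs \<alpha> True x y"
proof -
  let ?Q = "seqs2 \<alpha>"
  define P where "P p \<longleftrightarrow> (\<exists>x y. x \<^bold>\<in> ?Q \<and> y \<^bold>\<in> ?Q \<and> lexs \<alpha> True x y \<and> p = opair x y)" for p
  have P: "fo (\<lambda>e. P (e 0))" unfolding P_def lexs_def digit_def by (intro fo_intros)
  have "(\<exists>x y. x \<^bold>\<in> ?Q \<and> y \<^bold>\<in> ?Q \<and> lex_less \<alpha> x y \<and> p = opair x y) \<longleftrightarrow> P p" for p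
    unfolding P_def using lex_less_iff[OF \<alpha>] mem_seqs2 by blast
  then have "lex_order \<alpha> = setof P" unfolding lex_order_def by simp
  moreover have "\<exists>s. \<forall>p. p \<^bold>\<in> s \<longleftrightarrow> P p"
  proof -
    have "P p \<Longrightarrow> p \<^bold>\<in> cprod ?Q ?Q" for p unfolding P_def mem_cprod by blast
    then show ?thesis using fo_separation[OF P, of "cprod ?Q ?Q"] by blast
  qed
  ultimately have "opair x y \<^bold>\<in> lex_order \<alpha> \<longleftrightarrow> P (opair x y)" using mem_setof[of P] by simp
  then show ?thesis unfolding P_def using assms by auto
qed

text \<open>For a fixed representative, membership in the order type is first-order, so the
  \<open>setof\<close> in \<open>suborders\<close> denotes the intended set.\<close>

lemma mem_suborders: "Y \<^bold>\<in> suborders (X, R) (type_of (A, S)) \<longleftrightarrow>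
  Y \<^bold>\<subseteq> X \<and> linord (Y, R) \<and> order_iso (A, S) (Y, R)"
proof -
  have "fo (\<lambda>e. e 0 \<^bold>\<subseteq> X \<and> linord (e 0, R) \<and> order_iso (A, S) (e 0, R))"
    unfolding sub_def linord_def order_iso_iff riso_def split by (intro fo_intros)
  from mem_setof[OF fo_subset_bound[OF this], of X] show ?thesis
    unfolding suborders_def type_of_def by simp
qed

lemma linord_sub: "linord (X, R) \<Longrightarrow> Y \<^bold>\<subseteq> X \<Longrightarrow> linord (Y, R)"
  unfolding linord_def sub_def split by (intro conjI allI impI; elim conjE) metis+

theorem theorem1:
  fixes \<tau> :: "('a::zf) otype"
  assumes "order_type \<tau>" and "\<tau> \<noteq> ozero" and "\<tau> \<^bold>+ \<tau> \<^bold>\<le> \<tau>"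
  shows "\<forall>\<alpha>. ordinal \<alpha> \<longrightarrow> \<not> arrow (seqs2 \<alpha>, lex_order \<alpha>) \<tau> \<tau> two"
proof (intro allI impI notI)
  fix \<alpha> :: 'a
  assume \<alpha>: "ordinal \<alpha>" and arrow: "arrow (seqs2 \<alpha>, lex_order \<alpha>) \<tau> \<tau> two"
  let ?Q = "seqs2 \<alpha>" and ?R = "lex_order \<alpha>"
  obtain A S where \<tau>: "\<tau> = type_of (A, S)" using assms(1) unfolding order_type_def by auto
  have ne: "\<exists>a. a \<^bold>\<in> A"
  proof (rule ccontr)
    assume A: "\<not> ?thesis"
    \<comment> \<open>All orders on an empty carrier have the same isomorphisms, so an empty
      \<open>A\<close> would make \<open>\<tau>\<close> equal to \<open>ozero\<close>.\<close>
    have "riso P A S Y T \<longleftrightarrow> riso P emptyset emptyset Y T" for P Y T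
      using A unfolding riso_def by simp
    then have "order_iso (A, S) M \<longleftrightarrow> order_iso (emptyset, emptyset) M" for M
      by (cases M) (simp only: order_iso_iff)
    then show False using assms(2) unfolding \<tau> ozero_def type_of_def by simp
  qed
  let ?T = "suborders (?Q, ?R) \<tau>"
  \<comment> \<open>Within \<open>two\<close> the equivalence leaves exactly one value for
    \<open>c\<close>; sets that are not \<open>late_low\<close> receive
    \<open>emptyset\<close>.\<close>
  define F where "F = sep (cprod ?T two) (\<lambda>p. \<exists>B c. p = opair B c \<and> (c = one \<longleftrightarrow> late_low \<alpha> B))"
  have fo_low: "fo (\<lambda>e. \<exists>B c. e 0 = opair B c \<and> (c = one \<longleftrightarrow> late_low \<alpha> B))"
    unfolding late_low_def spl_def agrs_def agr_def digit_def by (intro fo_intros)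
  have F: "opair B c \<^bold>\<in> F \<longleftrightarrow> B \<^bold>\<in> ?T \<and> c \<^bold>\<in> two \<and> (c = one \<longleftrightarrow> late_low \<alpha> B)" for B c
    unfolding F_def mem_sep[OF fo_low] mem_cprod by auto
  have fF: "func F ?T two"
    unfolding func_def
  proof (intro conjI allI impI)
    fix p assume "p \<^bold>\<in> F"
    then show "\<exists>a b. a \<^bold>\<in> ?T \<and> b \<^bold>\<in> two \<and> p = opair a b"
      unfolding F_def mem_sep[OF fo_low] mem_cprod by blast
  next
    fix B assume B: "B \<^bold>\<in> ?T"
    show "\<exists>!c. opair B c \<^bold>\<in> F"
      by (rule ex1I[of _ "if late_low \<alpha> B then one else emptyset"]) (use B in \<open>auto simp: F\<close>)
  qed
  have low: "app F B = one \<longleftrightarrow> late_low \<alpha> B" if "B \<^bold>\<in> ?T" for B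
    using func_app(1)[OF fF that] unfolding F by simp
  obtain H c where H: "H \<^bold>\<in> ?T" and c: "\<forall>B. B \<^bold>\<in> suborders (H, ?R) \<tau> \<longrightarrow> app F B = c"
  proof -
    have "\<exists>H. H \<^bold>\<in> ?T \<and> (\<exists>!c. \<exists>B. B \<^bold>\<in> suborders (H, ?R) \<tau> \<and> app F B = c)"
      using arrow[unfolded arrow_def split, rule_format, OF fF] .
    then show thesis using that by blast
  qed
  have HQ: "H \<^bold>\<subseteq> ?Q" and lin: "linord (H, ?R)" and iso: "order_iso (A, S) (H, ?R)"
    using H unfolding \<tau> mem_suborders by blast+
  have R: "opair x y \<^bold>\<in> ?R \<longleftrightarrow> lexs \<alpha> True x y" if "x \<^bold>\<in> H" "y \<^bold>\<in> H" for x y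
    by (rule mem_lex_order[OF \<alpha> subD[OF HQ that(1)] subD[OF HQ that(2)]])
  have dbl: "\<exists>K1 K2. K1 \<^bold>\<subseteq> K \<and> K2 \<^bold>\<subseteq> K \<and> order_iso (A, S) (K1, ?R) \<and> order_iso (A, S) (K2, ?R) \<and>
        (\<forall>x y. x \<^bold>\<in> K1 \<and> y \<^bold>\<in> K2 \<longrightarrow> lexs \<alpha> True x y)"
    if KH: "K \<^bold>\<subseteq> H" and K: "order_iso (A, S) (K, ?R)" for K
  proof -
    have "(K, ?R) \<in> \<tau>" using K linord_sub[OF lin KH] unfolding \<tau> type_of_def by simp
    then obtain Y where Y: "Y \<^bold>\<subseteq> K" "(Y, ?R) \<in> \<tau> \<^bold>+ \<tau>" using assms(3) unfolding ole_def by blast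
    then obtain K1 K2 where K12: "(K1, ?R) \<in> \<tau>" "(K2, ?R) \<in> \<tau>"
      "\<forall>x. x \<^bold>\<in> Y \<longleftrightarrow> x \<^bold>\<in> K1 \<or> x \<^bold>\<in> K2" "\<forall>a b. a \<^bold>\<in> K1 \<and> b \<^bold>\<in> K2 \<longrightarrow> opair a b \<^bold>\<in> ?R"
      unfolding oplus_def by blast
    have sub: "K1 \<^bold>\<subseteq> K" "K2 \<^bold>\<subseteq> K" using K12(3) Y(1) unfolding sub_def by blast+
    have "lexs \<alpha> True x y" if "x \<^bold>\<in> K1" "y \<^bold>\<in> K2" for x y
      using K12(4) that R[OF subD[OF KH subD[OF sub(1) that(1)]] subD[OF KH subD[OF sub(2) that(2)]]]
      by blast
    then show ?thesis using sub K12(1,2) unfolding \<tau> type_of_def by blast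
  qed
  interpret lex_copies \<alpha> A S ?R H
  proof
    show "x = y" if "x \<^bold>\<in> H" "y \<^bold>\<in> H" "\<And>\<gamma>. \<gamma> \<^bold>\<in> \<alpha> \<Longrightarrow> digit x \<gamma> \<longleftrightarrow> digit y \<gamma>" for x y
      using seqs2_eqI[of x \<alpha> y] subD[OF HQ that(1)] subD[OF HQ that(2)] that(3)
      unfolding mem_seqs2 by blast
  qed (fact \<alpha>, fact R, fact ne, fact iso, fact dbl)
  have "B \<^bold>\<in> ?T" "app F B = c" if "copy B" for B
  proof -
    have B: "B \<^bold>\<subseteq> H" "order_iso (A, S) (B, ?R)" using that unfolding copy_def by blast+
    show "B \<^bold>\<in> ?T"
      unfolding \<tau> mem_suborders using B(2) linord_sub[OF lin B(1)] sub_trans[OF B(1) HQ] by blast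
    have "B \<^bold>\<in> suborders (H, ?R) \<tau>"
      unfolding \<tau> mem_suborders using B linord_sub[OF lin B(1)] by blast
    then show "app F B = c" using c by blast
  qed
  then have "late_low \<alpha> B \<longleftrightarrow> c = one" if "copy B" for B using low[of B] that by simp
  then show False using late_low_not_constant by blast
qed

end
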